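(* Let $n\ge1$ and let $q,\widetilde q,r,\widetilde r\in[1,\infty]$. Suppose that there is a constant $C$ such that $$\left\|\int_0^t e^{i(t-s)\Delta}F(\cdot,s)\,ds\right\|_{L^q_tL^r_x}\le C\,\|F\|_{L^{\widetilde q'}_tL^{\widetilde r'}_x}$$ for all $F$. Then $$\frac{n-2}{\widetilde r}-\frac2q\le\frac nr\qquad\text{and}\qquad \frac{n-2}{r}-\frac2{\widetilde q}\le\frac n{\widetilde r}.$$
   Context: Here $(x,t)\in\mathbb{R}^n\times\mathbb{R}$. For an exponent $p\in[1,\infty]$, $p'$ denotes the conjugate exponent, $\frac1p+\frac1{p'}=1$; $\widetilde q'$ and $\widetilde r'$ denote the conjugate exponents of $\widetilde q$ and $\widetilde r$. The mixed norm is $\|F\|_{L^q_tL^r_x}=\big\|\,\|F(\cdot,t)\|_{L^r(\mathbb{R}^n)}\big\|_{L^q(\mathbb{R},dt)}$. The free Schrödinger propagator is $$e^{it\Delta}f(x)=(2\pi)^{-n}\int_{\mathbb{R}^n}e^{ix\cdot\xi-it|\xi|^2}\widehat f(\xi)\,d\xi,\qquad \widehat f(\xi)=\int_{\mathbb{R}^n}e^{-ix\cdot\xi}f(x)\,dx,$$ and for a function $F(y,s)$ on $\mathbb{R}^n\times\mathbb{R}$, $$\int_0^te^{i(t-s)\Delta}F(\cdot,s)\,ds$$ is the Duhamel integral; for $t<0$ the integral $\int_0^t$ is oriented. The estimate is required for all bounded measurable compactly supported $F$ as well as for all Schwartz $F$ on $\mathbb{R}^{n+1}$. *)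

theory Defs
  imports "HOL-Analysis.Analysis" "HOL-Probability.Essential_Supremum"
begin

section \<open>Exponents and mixed Lebesgue norms\<close>

text \<open>Exponents in \<open>[1,\<infinity>]\<close> are elements of \<^typ>\<open>ennreal\<close>, where \<open>1 / \<infinity> = 0\<close> and \<open>1 / 0 = \<infinity>\<close>.\<close>

definition conjugate_exponent :: "ennreal \<Rightarrow> ennreal" where
  "conjugate_exponent p = 1 / (1 - 1 / p)"

lemma conjugate_exponent_unique:
  assumes "1 \<le> p"
  shows "1 / p + 1 / p' = 1 \<longleftrightarrow> p' = conjugate_exponent p"
proof -
  have le: "1 / p \<le> 1"
    using assms by (metis divide_le_posI_ennreal mult.right_neutral not_gr_zero not_one_le_zero)
  have inv: "1 / (1 / x) = x" for x :: ennreal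
  proof (cases x)
    case (real y)
    then show ?thesis
      by (cases "y = 0") (auto simp: divide_ennreal_def inverse_ennreal)
  qed (simp add: divide_ennreal_def)
  have "1 / p \<noteq> top"
    using le by (auto simp: top_unique)
  then have "1 / p + 1 / p' = 1 \<longleftrightarrow> 1 / p' = 1 - 1 / p"
    using le ennreal_ineq_diff_add[OF le] by (metis ennreal_add_diff_cancel_left)
  also have "\<dots> \<longleftrightarrow> p' = conjugate_exponent p"
    unfolding conjugate_exponent_def by (metis inv)
  finally show ?thesis .
qed

definition recip_exponent :: "ennreal \<Rightarrow> real" where
  "recip_exponent p = enn2real (1 / p)"

definition ennreal_powr :: "ennreal \<Rightarrow> real \<Rightarrow> ennreal" where
  "ennreal_powr x a = (if x = \<infinity> then \<infinity> else ennreal (enn2real x powr a))"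

text \<open>The functional is defined on \<open>[0,\<infinity>]\<close>-valued functions, because the inner norm in a mixed norm
  may be infinite. \<^const>\<open>ennreal_powr\<close> is only ever used with an exponent \<open>a > 0\<close>.\<close>

definition Lp_norm :: "'a measure \<Rightarrow> ennreal \<Rightarrow> ('a \<Rightarrow> ennreal) \<Rightarrow> ennreal" where
  "Lp_norm M p g =
     (if p = \<infinity> then esssup M g
      else ennreal_powr (\<integral>\<^sup>+ x. ennreal_powr (g x) (enn2real p) \<partial>M) (1 / enn2real p))"

definition mixed_norm ::
    "ennreal \<Rightarrow> ennreal \<Rightarrow> ((real ^ 'n) \<times> real \<Rightarrow> complex) \<Rightarrow> ennreal" where
  "mixed_norm q r F =
     Lp_norm lborel q (\<lambda>t. Lp_norm lborel r (\<lambda>x. ennreal (cmod (F (x, t)))))"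


section \<open>The two classes of forcing terms\<close>

primrec iterated_deriv ::
    "'a list \<Rightarrow> ('a::real_normed_vector \<Rightarrow> 'b::real_normed_vector) \<Rightarrow> 'a \<Rightarrow> 'b" where
  "iterated_deriv [] f = f"
| "iterated_deriv (v # vs) f = (\<lambda>x. frechet_derivative (iterated_deriv vs f) (at x) v)"

definition schwartz :: "('a::euclidean_space \<Rightarrow> complex) \<Rightarrow> bool" where
  "schwartz f \<longleftrightarrow>
     (\<forall>vs. set vs \<subseteq> Basis \<longrightarrow>
        iterated_deriv vs f differentiable_on UNIV \<and>
        (\<forall>k. bounded (range (\<lambda>x. norm x ^ k *\<^sub>R iterated_deriv vs f x))))"

definition bounded_compactly_supported :: "('a::euclidean_space \<Rightarrow> complex) \<Rightarrow> bool" where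
  "bounded_compactly_supported f \<longleftrightarrow>
     f \<in> borel_measurable borel \<and> bounded (range f) \<and> compact (closure {x. f x \<noteq> 0})"


section \<open>The free propagator and the Duhamel integral as absolutely convergent integrals\<close>

definition fourier :: "(real ^ 'n \<Rightarrow> complex) \<Rightarrow> real ^ 'n \<Rightarrow> complex" where
  "fourier f \<xi> = (\<integral>x. cis (- (x \<bullet> \<xi>)) * f x \<partial>lborel)"

definition schrodinger :: "real \<Rightarrow> (real ^ 'n \<Rightarrow> complex) \<Rightarrow> real ^ 'n \<Rightarrow> complex" where
  "schrodinger t f x =
     (1 / (2 * pi) ^ CARD('n)) *\<^sub>R
       (\<integral>\<xi>. cis (x \<bullet> \<xi> - t * (norm \<xi>)\<^sup>2) * fourier f \<xi> \<partial>lborel)"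

definition duhamel ::
    "((real ^ 'n) \<times> real \<Rightarrow> complex) \<Rightarrow> (real ^ 'n) \<times> real \<Rightarrow> complex" where
  "duhamel F = (\<lambda>(x, t). LBINT s=ereal 0..ereal t. schrodinger (t - s) (\<lambda>y. F (y, s)) x)"


section \<open>The free propagator and the Duhamel integral in the \<open>L\<^sup>2\<close> sense\<close>

text \<open>For a bounded compactly supported \<open>f\<close> the Fourier transform is in \<open>L\<^sup>2\<close> but in general not
  integrable, so the inversion integral in \<^const>\<open>schrodinger\<close> need not converge absolutely and has to
  be read in the sense of Plancherel's theorem: as the \<open>L\<^sup>2\<close> limit of the integrals over balls.
  Since this determines the propagated function only almost everywhere, the notions
  below are predicates on representatives.\<close>

definition in_L2 :: "(real ^ 'n \<Rightarrow> complex) \<Rightarrow> bool" where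
  "in_L2 f \<longleftrightarrow> f \<in> borel_measurable borel \<and> Lp_norm lborel 2 (\<lambda>x. ennreal (cmod (f x))) < \<infinity>"

definition schrodinger_trunc ::
    "real \<Rightarrow> real \<Rightarrow> (real ^ 'n \<Rightarrow> complex) \<Rightarrow> real ^ 'n \<Rightarrow> complex" where
  "schrodinger_trunc R t f x =
     (1 / (2 * pi) ^ CARD('n)) *\<^sub>R
       (LINT \<xi>:cball 0 R|lborel. cis (x \<bullet> \<xi> - t * (norm \<xi>)\<^sup>2) * fourier f \<xi>)"

definition is_schrodinger :: "real \<Rightarrow> (real ^ 'n \<Rightarrow> complex) \<Rightarrow> (real ^ 'n \<Rightarrow> complex) \<Rightarrow> bool" where
  "is_schrodinger t f g \<longleftrightarrow>
     in_L2 g \<and>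
     ((\<lambda>R. Lp_norm lborel 2 (\<lambda>x. ennreal (cmod (schrodinger_trunc R t f x - g x)))) \<longlongrightarrow> 0) at_top"

definition L2_inner :: "(real ^ 'n \<Rightarrow> complex) \<Rightarrow> (real ^ 'n \<Rightarrow> complex) \<Rightarrow> complex" where
  "L2_inner g h = (\<integral>x. g x * cnj (h x) \<partial>lborel)"

text \<open>\<open>u(\<cdot>,t)\<close> is the integral from \<open>0\<close> to \<open>t\<close> of the \<open>L\<^sup>2\<close>-valued function \<open>s \<mapsto> V s\<close>, where \<open>V s\<close>
  represents the propagation of \<open>F(\<cdot>,s)\<close> over time \<open>t - s\<close>. As there is no type of \<open>L\<^sup>2\<close> classes,
  this vector-valued integral is expressed by testing against all \<open>h\<close> in \<open>L\<^sup>2\<close>, so that it does not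
  depend on the choice of representatives.\<close>

definition is_duhamel ::
    "((real ^ 'n) \<times> real \<Rightarrow> complex) \<Rightarrow> ((real ^ 'n) \<times> real \<Rightarrow> complex) \<Rightarrow> bool" where
  "is_duhamel F u \<longleftrightarrow>
     u \<in> borel_measurable borel \<and>
     (\<forall>t. in_L2 (\<lambda>x. u (x, t)) \<and>
       (\<exists>V. (\<forall>s. is_schrodinger (t - s) (\<lambda>y. F (y, s)) (V s)) \<and>
         (\<forall>h. in_L2 h \<longrightarrow>
            interval_lebesgue_integrable lborel (ereal 0) (ereal t) (\<lambda>s. L2_inner (V s) h) \<and>
            L2_inner (\<lambda>x. u (x, t)) h = (LBINT s=ereal 0..ereal t. L2_inner (V s) h))))"

end

theory Submission
  imports Defs "HOL-Probability.Characteristic_Functions" "HOL-Complex_Analysis.Conformal_Mappings"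
begin

text \<open>
  Write \<open>n\<close> for the dimension and \<open>1/p\<close> for \<open>recip_exponent p\<close>. The estimate forces the stronger pair of
  inequalities \<open>n/rt \<le> n/r + 2/q\<close> and \<open>n/r \<le> n/rt + 2/qt\<close>, from which the two asserted ones follow
  by subtracting the nonnegative terms \<open>2/rt\<close> and \<open>2/r\<close>. Each is read off from a one-parameter
  family of Schwartz forcing terms as the parameter \<open>\<delta>\<close> tends to \<open>0\<close>.

  The forcing terms have the form \<open>F(x,s) = a(s - s\<^sub>0) g(x,s)\<close>, where \<open>g\<close> is the free solution which is
  a Gaussian of width \<open>sqrt \<delta>\<close> at time \<open>s\<^sub>0\<close> (\<open>wave_packet\<close>). As the propagator
  carries \<open>g\<close> at time \<open>s\<close> to \<open>g\<close> at time \<open>t\<close>, the Duhamel integral is \<open>g(x,t)\<close> times the integral of \<open>a(s - s\<^sub>0)\<close> over \<open>[0,t]\<close>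
  (\<open>duhamel_wave_packet\<close>), so both sides of the estimate are norms of explicit
  Gaussians. Normalised to height \<open>1\<close> at time \<open>s\<^sub>0\<close>, the solution \<open>g\<close> lives on \<open>|x| \<le> sqrt \<delta>\<close> for
  \<open>|s - s\<^sub>0| \<le> \<delta>\<close>, and for \<open>|s - s\<^sub>0|\<close> of order \<open>1\<close> it has height \<open>\<delta> powr (n/2)\<close> and
  width \<open>1/sqrt \<delta>\<close>.

  \<^item> Focusing (\<open>focusing_condition\<close>): force while \<open>g\<close> is spread out, with \<open>s\<^sub>0 = 1\<close> and \<open>a\<close>
    independent of \<open>\<delta>\<close>, and observe the solution near the focus, for \<open>t\<close> in \<open>[1,1+\<delta>]\<close>. The norm of
    the forcing is at most of order \<open>\<delta> powr (n/(2 rt))\<close>, that of the solution at least of order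
    \<open>\<delta> powr (n/(2 r) + 1/q)\<close>. The amplitude \<open>a\<close> vanishes to order \<open>2n\<close> at \<open>0\<close>, so that the
    forcing near the focus does not spoil the bound, whatever the exponents are.
  \<^item> Dispersing (\<open>dispersing_condition\<close>): force during the time \<open>\<delta>\<close> around the focus \<open>s\<^sub>0 = 0\<close> and
    observe the solution for \<open>t\<close> in \<open>[1,2]\<close>, when it is spread out. The roles of the two sides of the estimate are
    interchanged, as under duality.

  The propagation law for Gaussians is the Fourier transform of \<open>exp (-z |\<xi>|\<^sup>2)\<close> for complex \<open>z\<close>
  (\<open>complex_gaussian_fourier\<close>), which is continued analytically from the characteristic function of the
  normal distribution.
\<close>

section \<open>Fourier transforms of complex Gaussians\<close>

lemma cis_measurable [measurable]: "cis \<in> borel_measurable borel"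
  by (intro borel_measurable_continuous_onI continuous_intros)

lemma real_gaussian_fourier:
  fixes a x :: real
  assumes "a > 0"
  shows "integrable lborel (\<lambda>\<xi>. cis (x * \<xi>) * exp (- of_real (a * \<xi>\<^sup>2)))" (is ?A)
    and "(\<integral>\<xi>. cis (x * \<xi>) * exp (- of_real (a * \<xi>\<^sup>2)) \<partial>lborel)
           = of_real (sqrt (pi / a) * exp (- x\<^sup>2 / (4 * a)))" (is ?B)
proof -
  define c where "c = sqrt (2 * a)"
  have c: "c > 0" "c\<^sup>2 = 2 * a"
    using assms by (auto simp: c_def)
  define g where "g = (\<lambda>y. std_normal_density y *\<^sub>R cis (x / c * y))"
  have g: "integrable lborel g"
    by (rule Bochner_Integration.integrable_bound[OF integrable_normal_density[of 1 0]])
       (auto simp: g_def)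
  have "integral\<^sup>L lborel g = char std_normal_distribution (x / c)"
    unfolding char_def g_def by (subst integral_density) (auto simp: cis_conv_exp)
  also have "\<dots> = of_real (exp (- x\<^sup>2 / (4 * a)))"
    by (simp add: char_std_normal_distribution power_divide c)
  finally have Ig: "integral\<^sup>L lborel g = of_real (exp (- x\<^sup>2 / (4 * a)))" .
  have eq: "cis (x * \<xi>) * exp (- of_real (a * \<xi>\<^sup>2)) = sqrt (2 * pi) *\<^sub>R g (0 + c * \<xi>)" for \<xi>
  proof -
    have "exp (- of_real (a * \<xi>\<^sup>2)) = complex_of_real (exp (- (c * \<xi>)\<^sup>2 / 2))"
      by (simp add: power_mult_distrib c flip: exp_of_real)
    then show ?thesis
      using c by (simp add: g_def std_normal_density_def scaleR_conv_of_real)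
  qed
  show ?A
    unfolding eq using lborel_integrable_real_affine[OF g, of c 0] c
    by (intro integrable_scaleR_right) auto
  have "(\<integral>\<xi>. g (0 + c * \<xi>) \<partial>lborel) = (1 / c) *\<^sub>R integral\<^sup>L lborel g"
    using lborel_integral_real_affine[of c g 0] c by simp
  moreover have "sqrt (pi / a) = sqrt (2 * pi) * (1 / c)"
    using assms by (simp add: c_def real_sqrt_mult real_sqrt_divide)
  ultimately show ?B
    unfolding eq integral_scaleR_right by (simp only: Ig scaleR_conv_of_real of_real_mult mult.assoc)
qed

lemma integrable_gaussian_real:
  assumes "a > 0"
  shows "integrable lborel (\<lambda>\<xi>::real. exp (- (a * \<xi>\<^sup>2)))"
  using integrable_norm[OF real_gaussian_fourier(1)[OF assms, of 0]] by simp

lemma integrable_bounded_times_gaussian: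
  fixes g :: "real \<Rightarrow> complex"
  assumes [measurable]: "g \<in> borel_measurable borel" and "\<And>\<xi>. cmod (g \<xi>) \<le> 1" and "Re z > 0"
  shows "integrable lborel (\<lambda>\<xi>. g \<xi> * exp (- z * of_real (\<xi>\<^sup>2)))"
proof (rule Bochner_Integration.integrable_bound[OF integrable_gaussian_real[OF \<open>Re z > 0\<close>]])
  show "AE \<xi> in lborel. norm (g \<xi> * exp (- z * of_real (\<xi>\<^sup>2))) \<le> norm (exp (- (Re z * \<xi>\<^sup>2)))"
    using assms(2) by (intro always_eventually allI) (simp add: norm_mult mult_left_le_one_le)
qed measurable

text \<open>Differentiation under the integral sign: the difference quotients of \<open>exp (-z \<xi>\<^sup>2)\<close> in \<open>z\<close> are dominated
  by a real Gaussian as long as the increment has modulus at most \<open>Re z / 2\<close>.\<close>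

lemma holomorphic_gaussian_integral:
  fixes g :: "real \<Rightarrow> complex"
  assumes [measurable]: "g \<in> borel_measurable borel" and g1: "\<And>\<xi>. cmod (g \<xi>) \<le> 1"
  shows "(\<lambda>z. \<integral>\<xi>. g \<xi> * exp (- z * of_real (\<xi>\<^sup>2)) \<partial>lborel) holomorphic_on {z. Re z > 0}"
    (is "?f holomorphic_on _")
proof -
  have "\<exists>D. (?f has_field_derivative D) (at z)" if z: "Re z > 0" for z
  proof -
    define D where "D = (\<integral>\<xi>. g \<xi> * (- of_real (\<xi>\<^sup>2) * exp (- z * of_real (\<xi>\<^sup>2))) \<partial>lborel)"
    define c where "c = Re z / 2"
    have c: "c > 0" using z by (simp add: c_def)
    define Q where "Q = (\<lambda>h \<xi>. (exp (- h * of_real (\<xi>\<^sup>2)) - 1) / h * exp (- z * of_real (\<xi>\<^sup>2)))"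
    have [measurable]: "Q h \<in> borel_measurable borel" for h
      unfolding Q_def by measurable
    have bound: "cmod (Q h \<xi>) \<le> 2 / c * exp (- (c / 2 * \<xi>\<^sup>2))"
      if h: "cmod h \<le> c" for h \<xi>
    proof -
      have "cmod ((exp (- h * of_real (\<xi>\<^sup>2)) - 1) / h) \<le> exp (c * \<xi>\<^sup>2) * \<xi>\<^sup>2"
      proof (cases "h = 0")
        case False
        have "cmod (exp (- h * of_real (\<xi>\<^sup>2)) - 1) \<le> exp (cmod h * \<xi>\<^sup>2) * (cmod h * \<xi>\<^sup>2)"
          using Taylor_exp_field[of "- h * of_real (\<xi>\<^sup>2)" 0] by (simp add: norm_mult norm_power)
        also have "\<dots> \<le> exp (c * \<xi>\<^sup>2) * (cmod h * \<xi>\<^sup>2)"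
          using h by (intro mult_right_mono) (auto intro: mult_right_mono)
        finally show ?thesis
          using False by (simp add: norm_divide field_simps)
      qed simp
      then have "cmod (Q h \<xi>) \<le> (exp (c * \<xi>\<^sup>2) * \<xi>\<^sup>2) * exp (- (Re z * \<xi>\<^sup>2))"
        unfolding Q_def norm_mult by (intro mult_mono) auto
      also have "\<dots> = \<xi>\<^sup>2 * exp (- (c * \<xi>\<^sup>2))"
        by (simp add: c_def flip: exp_add)
      also have "\<dots> \<le> 2 / c * exp (c / 2 * \<xi>\<^sup>2) * exp (- (c * \<xi>\<^sup>2))"
      proof (intro mult_right_mono)
        have "c / 2 * \<xi>\<^sup>2 \<le> exp (c / 2 * \<xi>\<^sup>2)"
          using exp_ge_add_one_self[of "c / 2 * \<xi>\<^sup>2"] by linarith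
        then show "\<xi>\<^sup>2 \<le> 2 / c * exp (c / 2 * \<xi>\<^sup>2)"
          using c by (simp add: field_simps)
      qed simp
      also have "\<dots> = 2 / c * exp (- (c / 2 * \<xi>\<^sup>2))"
        by (simp add: mult.assoc flip: exp_add)
      finally show ?thesis .
    qed
    have "(\<lambda>h. (?f (z + h) - ?f z) / h) \<midarrow>0\<rightarrow> D"
      unfolding tendsto_at_iff_sequentially comp_def
    proof (intro allI impI)
      fix X :: "nat \<Rightarrow> complex"
      assume X0: "\<forall>i. X i \<in> UNIV - {0}" and X: "X \<longlonglongrightarrow> 0"
      have "eventually (\<lambda>i. cmod (X i) < c) sequentially"
        using order_tendstoD(2)[OF tendsto_norm[OF X]] c by simp
      then obtain N where N: "\<And>i. i \<ge> N \<Longrightarrow> cmod (X i) < c"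
        by (auto simp: eventually_sequentially)
      have "(\<lambda>i. \<integral>\<xi>. g \<xi> * Q (X (i + N)) \<xi> \<partial>lborel) \<longlonglongrightarrow> D"
        unfolding D_def
      proof (rule integral_dominated_convergence)
        show "integrable lborel (\<lambda>\<xi>::real. 2 / c * exp (- (c / 2 * \<xi>\<^sup>2)))"
          using c by (intro integrable_mult_right integrable_gaussian_real) auto
        show "AE \<xi> in lborel. norm (g \<xi> * Q (X (i + N)) \<xi>) \<le> 2 / c * exp (- (c / 2 * \<xi>\<^sup>2))" for i
        proof (intro always_eventually allI)
          fix \<xi>
          have "norm (g \<xi> * Q (X (i + N)) \<xi>) \<le> norm (Q (X (i + N)) \<xi>)"
            using g1[of \<xi>] by (simp add: norm_mult mult_left_le_one_le)
          also have "\<dots> \<le> 2 / c * exp (- (c / 2 * \<xi>\<^sup>2))"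
            using N[of "i + N"] by (intro bound) auto
          finally show "norm (g \<xi> * Q (X (i + N)) \<xi>) \<le> 2 / c * exp (- (c / 2 * \<xi>\<^sup>2))" .
        qed
        show "AE \<xi> in lborel. (\<lambda>i. g \<xi> * Q (X (i + N)) \<xi>) \<longlonglongrightarrow>
                g \<xi> * (- of_real (\<xi>\<^sup>2) * exp (- z * of_real (\<xi>\<^sup>2)))"
        proof (intro always_eventually allI tendsto_mult tendsto_const)
          fix \<xi>
          have "((\<lambda>h. exp (- h * of_real (\<xi>\<^sup>2))) has_field_derivative - of_real (\<xi>\<^sup>2)) (at (0::complex))"
            by (auto intro!: derivative_eq_intros)
          then have "(\<lambda>h. (exp (- h * of_real (\<xi>\<^sup>2)) - 1) / h) \<midarrow>(0::complex)\<rightarrow> - of_real (\<xi>\<^sup>2)"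
            by (simp add: DERIV_def)
          moreover have "filterlim (\<lambda>i. X (i + N)) (at 0) sequentially"
            using X0 LIMSEQ_ignore_initial_segment[OF X, of N]
            by (auto simp: filterlim_at)
          ultimately have "(\<lambda>i. (exp (- X (i + N) * of_real (\<xi>\<^sup>2)) - 1) / X (i + N)) \<longlonglongrightarrow> - of_real (\<xi>\<^sup>2)"
            by (rule filterlim_compose)
          then show "(\<lambda>i. Q (X (i + N)) \<xi>) \<longlonglongrightarrow> - of_real (\<xi>\<^sup>2) * exp (- z * of_real (\<xi>\<^sup>2))"
            unfolding Q_def by (intro tendsto_mult tendsto_const)
        qed
      qed measurable
      moreover have "(\<integral>\<xi>. g \<xi> * Q (X (i + N)) \<xi> \<partial>lborel) = (?f (z + X (i + N)) - ?f z) / X (i + N)" for i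
      proof -
        have "Re (z + X (i + N)) > 0"
          using N[of "i + N"] abs_Re_le_cmod[of "X (i + N)"] c by (simp add: c_def)
        then have "?f (z + X (i + N)) - ?f z =
            (\<integral>\<xi>. g \<xi> * exp (- (z + X (i + N)) * of_real (\<xi>\<^sup>2)) - g \<xi> * exp (- z * of_real (\<xi>\<^sup>2)) \<partial>lborel)"
          using z g1 by (intro Bochner_Integration.integral_diff[symmetric] integrable_bounded_times_gaussian) auto
        then have "(?f (z + X (i + N)) - ?f z) / X (i + N) =
            (\<integral>\<xi>. (g \<xi> * exp (- (z + X (i + N)) * of_real (\<xi>\<^sup>2)) - g \<xi> * exp (- z * of_real (\<xi>\<^sup>2))) / X (i + N) \<partial>lborel)"
          by simp
        also have "\<dots> = (\<integral>\<xi>. g \<xi> * Q (X (i + N)) \<xi> \<partial>lborel)"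
        proof (intro Bochner_Integration.integral_cong refl)
          fix \<xi>
          have "exp (- (z + X (i + N)) * of_real (\<xi>\<^sup>2)) = exp (- X (i + N) * of_real (\<xi>\<^sup>2)) * exp (- z * of_real (\<xi>\<^sup>2))"
            by (simp add: algebra_simps flip: exp_add)
          then show "(g \<xi> * exp (- (z + X (i + N)) * of_real (\<xi>\<^sup>2)) - g \<xi> * exp (- z * of_real (\<xi>\<^sup>2))) / X (i + N)
              = g \<xi> * Q (X (i + N)) \<xi>"
            by (simp only: Q_def left_diff_distrib right_diff_distrib diff_divide_distrib mult_1_left
                  times_divide_eq_right times_divide_eq_left mult.assoc)
        qed
        finally show ?thesis by simp
      qed
      ultimately have "(\<lambda>i. (?f (z + X (i + N)) - ?f z) / X (i + N)) \<longlonglongrightarrow> D"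
        by simp
      then show "(\<lambda>i. (?f (z + X i) - ?f z) / X i) \<longlonglongrightarrow> D"
        by (rule LIMSEQ_offset)
    qed
    then show ?thesis
      unfolding DERIV_def by blast
  qed
  then show ?thesis
    by (auto simp: holomorphic_on_def field_differentiable_def intro: has_field_derivative_at_within)
qed

text \<open>Both sides are holomorphic in \<open>z\<close> on the right half plane and agree on the positive real axis.
  The root of \<open>z\<close> is written with the principal logarithm, which is what makes the right-hand side holomorphic.\<close>

lemma complex_gaussian_fourier_1d:
  assumes "Re z > 0"
  shows "integrable lborel (\<lambda>\<xi>. cis (x * \<xi>) * exp (- z * of_real (\<xi>\<^sup>2)))"
    and "(\<integral>\<xi>. cis (x * \<xi>) * exp (- z * of_real (\<xi>\<^sup>2)) \<partial>lborel)
           = of_real (sqrt pi) * exp (- Ln z / 2 - of_real (x\<^sup>2) / (4 * z))"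
proof -
  show "integrable lborel (\<lambda>\<xi>. cis (x * \<xi>) * exp (- z * of_real (\<xi>\<^sup>2)))"
    using assms by (intro integrable_bounded_times_gaussian) auto
  let ?S = "{z. Re z > 0}"
  show "(\<integral>\<xi>. cis (x * \<xi>) * exp (- z * of_real (\<xi>\<^sup>2)) \<partial>lborel)
           = of_real (sqrt pi) * exp (- Ln z / 2 - of_real (x\<^sup>2) / (4 * z))"
    (is "?f z = ?g z")
  proof -
    have "?f z - ?g z = 0"
    proof (rule analytic_continuation[where f = "\<lambda>z. ?f z - ?g z" and S = ?S and U = "of_real ` {0<..}" and \<xi> = 1])
      have "?g holomorphic_on ?S"
        by (auto intro!: holomorphic_intros simp: complex_nonpos_Reals_iff)
      then show "(\<lambda>z. ?f z - ?g z) holomorphic_on ?S"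
        by (intro holomorphic_on_diff holomorphic_gaussian_integral) auto
      show "open ?S" by (rule open_halfspace_Re_gt)
      show "connected ?S" by (intro convex_connected convex_halfspace_Re_gt)
      show "complex_of_real ` {0<..} \<subseteq> ?S" by auto
      show "(1::complex) islimpt complex_of_real ` {0<..}"
        unfolding islimpt_approachable
      proof (intro allI impI)
        fix e :: real assume "e > 0"
        then show "\<exists>x'\<in>complex_of_real ` {0<..}. x' \<noteq> 1 \<and> dist x' 1 < e"
          by (intro bexI[of _ "complex_of_real (1 + e / 2)"] imageI) (simp_all add: dist_norm)
      qed
      show "?f z - ?g z = 0" if "z \<in> complex_of_real ` {0<..}" for z
      proof -
        obtain a where a: "z = of_real a" "a > 0" using \<open>z \<in> _\<close> by auto
        have "exp (- Ln z / 2) = of_real (exp (- ln a / 2))"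
          using a by (simp add: Ln_of_real flip: exp_of_real)
        also have "exp (- ln a / 2) = 1 / sqrt a"
          using a by (simp add: ln_sqrt[symmetric] exp_minus field_simps)
        finally have E: "exp (- Ln z / 2) = of_real (1 / sqrt a)" .
        have "- (of_real (x\<^sup>2) / (4 * z)) = complex_of_real (- x\<^sup>2 / (4 * a))"
          unfolding a(1) by simp
        then have "?g z = of_real (sqrt pi) * (of_real (1 / sqrt a) * of_real (exp (- x\<^sup>2 / (4 * a))))"
          unfolding diff_conv_add_uminus exp_add E by (simp only: exp_of_real)
        also have "\<dots> = of_real (sqrt (pi / a) * exp (- x\<^sup>2 / (4 * a)))"
          unfolding real_sqrt_divide of_real_mult[symmetric] by simp
        finally have "?g z = of_real (sqrt (pi / a) * exp (- x\<^sup>2 / (4 * a)))" .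
        then show ?thesis
          using real_gaussian_fourier(2)[of a x] a by simp
      qed
    qed (use assms in auto)
    then show ?thesis by simp
  qed
qed

lemma
  fixes f :: "'a::euclidean_space \<Rightarrow> real \<Rightarrow> complex"
  assumes "\<And>b. b \<in> Basis \<Longrightarrow> integrable lborel (f b)"
  shows integrable_lborel_prod: "integrable lborel (\<lambda>x. \<Prod>b\<in>Basis. f b (x \<bullet> b))"
    and integral_lborel_prod:
      "(\<integral>x. (\<Prod>b\<in>Basis. f b (x \<bullet> b)) \<partial>lborel) = (\<Prod>b\<in>Basis. integral\<^sup>L lborel (f b))"
proof -
  interpret product_sigma_finite "\<lambda>b::'a. lborel :: real measure" ..
  have [measurable]: "f b \<in> borel_measurable borel" if "b \<in> Basis" for b
    using borel_measurable_integrable[OF assms[OF that]] by simp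
  have m: "(\<lambda>x. \<Prod>b\<in>Basis. f b (x \<bullet> b)) \<in> borel_measurable borel"
    by measurable
  have *: "(\<Prod>b\<in>Basis. f b ((\<Sum>b\<in>Basis. y b *\<^sub>R b) \<bullet> b)) = (\<Prod>b\<in>Basis. f b (y b))" for y :: "'a \<Rightarrow> real"
    by (intro prod.cong) auto
  have T: "(\<lambda>f. \<Sum>b\<in>Basis. f b *\<^sub>R b) \<in> (\<Pi>\<^sub>M b\<in>(Basis::'a set). (lborel::real measure)) \<rightarrow>\<^sub>M borel"
    by measurable
  show "integrable lborel (\<lambda>x. \<Prod>b\<in>Basis. f b (x \<bullet> b))"
    using product_integrable_prod[OF finite_Basis assms]
    by (subst lborel_eq, subst integrable_distr_eq[OF T m]) (simp add: *)
  show "(\<integral>x. (\<Prod>b\<in>Basis. f b (x \<bullet> b)) \<partial>lborel) = (\<Prod>b\<in>Basis. integral\<^sup>L lborel (f b))"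
    using product_integral_prod[OF finite_Basis assms]
    by (subst lborel_eq, subst integral_distr[OF T m]) (simp add: *)
qed

lemma complex_gaussian_fourier:
  fixes x :: "'a::euclidean_space"
  assumes "Re z > 0"
  shows "integrable lborel (\<lambda>\<xi>. cis (x \<bullet> \<xi>) * exp (- z * of_real ((norm \<xi>)\<^sup>2)))"
    and "(\<integral>\<xi>. cis (x \<bullet> \<xi>) * exp (- z * of_real ((norm \<xi>)\<^sup>2)) \<partial>lborel)
           = of_real (sqrt pi ^ DIM('a)) * exp (- of_nat DIM('a) / 2 * Ln z - of_real ((norm x)\<^sup>2) / (4 * z))"
proof -
  have sq: "(norm y)\<^sup>2 = (\<Sum>b\<in>Basis. (y \<bullet> b)\<^sup>2)" for y :: 'a
    unfolding power2_norm_eq_inner by (simp add: euclidean_inner[of y y] power2_eq_square)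
  let ?f = "\<lambda>b \<xi>. cis ((x \<bullet> b) * \<xi>) * exp (- z * of_real (\<xi>\<^sup>2))"
  have cis_sum: "cis (\<Sum>b\<in>B. h b) = (\<Prod>b\<in>B. cis (h b))" if "finite B" for h and B :: "'a set"
    using that by (induction B) (auto simp flip: cis_mult)
  have eq: "cis (x \<bullet> \<xi>) * exp (- z * of_real ((norm \<xi>)\<^sup>2)) = (\<Prod>b\<in>Basis. ?f b (\<xi> \<bullet> b))" for \<xi>
  proof -
    have "- z * of_real ((norm \<xi>)\<^sup>2) = (\<Sum>b\<in>Basis. - z * of_real ((\<xi> \<bullet> b)\<^sup>2))"
      by (simp add: sq sum_distrib_left sum_negf)
    then show ?thesis
      by (simp only: euclidean_inner[of x \<xi>] cis_sum finite_Basis prod.distrib exp_sum)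
  qed
  have int: "integrable lborel (?f b)" for b
    by (rule complex_gaussian_fourier_1d[OF assms])
  show "integrable lborel (\<lambda>\<xi>. cis (x \<bullet> \<xi>) * exp (- z * of_real ((norm \<xi>)\<^sup>2)))"
    unfolding eq by (rule integrable_lborel_prod[OF int])
  show "(\<integral>\<xi>. cis (x \<bullet> \<xi>) * exp (- z * of_real ((norm \<xi>)\<^sup>2)) \<partial>lborel)
           = of_real (sqrt pi ^ DIM('a)) * exp (- of_nat DIM('a) / 2 * Ln z - of_real ((norm x)\<^sup>2) / (4 * z))"
  proof -
    have "(\<Sum>b\<in>Basis. - Ln z / 2 - of_real ((x \<bullet> b)\<^sup>2) / (4 * z)) =
        - of_nat DIM('a) / 2 * Ln z - of_real ((norm x)\<^sup>2) / (4 * z)"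
      by (simp add: sq sum_subtractf sum_divide_distrib)
    then show ?thesis
      unfolding eq integral_lborel_prod[OF int] complex_gaussian_fourier_1d(2)[OF assms]
      by (simp only: prod.distrib prod_constant exp_sum[OF finite_Basis, symmetric] of_real_power)
  qed
qed

section \<open>Propagation of Gaussians\<close>

text \<open>The Gaussian of complex squared width \<open>4z\<close>, normalised to have constant mass. For \<open>z = \<delta> + \<i>t\<close> it
  is the free solution at time \<open>t\<close> whose datum at time \<open>0\<close> has width of order \<open>sqrt \<delta>\<close>; the
  logarithm stands for the principal branch of \<open>z\<close> to the power \<open>-n/2\<close>.\<close>

definition gauss_wave :: "complex \<Rightarrow> real ^ 'n \<Rightarrow> complex" where
  "gauss_wave z x = exp (- of_nat CARD('n) / 2 * Ln z - of_real ((norm x)\<^sup>2) / (4 * z))"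

lemma fourier_gauss_wave:
  fixes \<xi> :: "real ^ 'n"
  assumes "Re z > 0"
  shows "fourier (gauss_wave z) \<xi> = of_real ((2 * sqrt pi) ^ CARD('n)) * exp (- z * of_real ((norm \<xi>)\<^sup>2))"
proof -
  define n where "n = CARD('n)"
  have z: "z \<noteq> 0" using assms by auto
  have "Re (1 / (4 * z)) > 0"
    using assms by (auto simp: Re_divide intro!: divide_pos_pos add_pos_nonneg)
  note G = complex_gaussian_fourier(2)[OF this, of "- \<xi>"]
  have "Ln (1 / (4 * z)) = Ln (inverse (of_real 4 * z))"
    by (simp add: inverse_eq_divide)
  also have "\<dots> = - Ln (of_real 4 * z)"
    using assms by (intro Ln_inverse) (auto simp: complex_nonpos_Reals_iff)
  also have "\<dots> = - (of_real (ln 4) + Ln z)"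
    using Ln_times_of_real[of 4 z] Ln_of_real[of 4] z by simp
  finally have L: "Ln (1 / (4 * z)) = - (of_real (2 * ln 2) + Ln z)"
    using ln_realpow[of 2 2] by simp
  have "fourier (gauss_wave z) \<xi> =
      (\<integral>x. exp (- of_nat n / 2 * Ln z) *
         (cis (- \<xi> \<bullet> x) * exp (- (1 / (4 * z)) * of_real ((norm x)\<^sup>2))) \<partial>lborel)"
    unfolding fourier_def gauss_wave_def n_def
    by (intro Bochner_Integration.integral_cong refl)
       (simp add: inner_commute mult_ac flip: exp_add)
  also have "\<dots> = exp (- of_nat n / 2 * Ln z) * (of_real (sqrt pi ^ n) *
      exp (- of_nat n / 2 * Ln (1 / (4 * z)) - of_real ((norm \<xi>)\<^sup>2) * z))"
    unfolding integral_mult_right_zero G by (simp add: n_def)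
  also have "\<dots> = of_real (sqrt pi ^ n) * exp (of_nat n * of_real (ln 2)) * exp (- z * of_real ((norm \<xi>)\<^sup>2))"
    unfolding L by (simp add: algebra_simps add_divide_distrib flip: exp_add)
  also have "exp (of_nat n * of_real (ln 2)) = complex_of_real (2 ^ n)"
    by (simp add: exp_of_nat_mult exp_of_real)
  finally show ?thesis
    by (simp add: n_def power_mult_distrib)
qed

lemma schrodinger_gauss_wave:
  assumes "Re z > 0"
  shows "schrodinger \<tau> (gauss_wave z) x = gauss_wave (z + \<i> * of_real \<tau>) (x :: real ^ 'n)"
proof -
  define n where "n = CARD('n)"
  define w where "w = z + \<i> * of_real \<tau>"
  have w: "Re w > 0" using assms by (simp add: w_def)
  have "cis (x \<bullet> \<xi> - \<tau> * (norm \<xi>)\<^sup>2) * fourier (gauss_wave z) \<xi> =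
      of_real ((2 * sqrt pi) ^ n) * (cis (x \<bullet> \<xi>) * exp (- w * of_real ((norm \<xi>)\<^sup>2)))" for \<xi>
    unfolding fourier_gauss_wave[OF assms] cis_conv_exp w_def n_def
    by (simp add: algebra_simps flip: exp_add)
  then have "schrodinger \<tau> (gauss_wave z) x =
      (1 / (2 * pi) ^ n) *\<^sub>R (of_real ((2 * sqrt pi) ^ n) * (of_real (sqrt pi ^ n) * gauss_wave w x))"
    unfolding schrodinger_def n_def
    by (simp only: integral_mult_right_zero complex_gaussian_fourier(2)[OF w] gauss_wave_def DIM_cart DIM_real mult_1_right)
  also have "\<dots> = of_real (1 / (2 * pi) ^ n * ((2 * sqrt pi) * sqrt pi) ^ n) * gauss_wave w x"
    by (simp only: scaleR_conv_of_real power_mult_distrib of_real_mult mult.assoc)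
  also have "1 / (2 * pi) ^ n * ((2 * sqrt pi) * sqrt pi) ^ n = 1"
    by (simp add: mult.assoc)
  finally show ?thesis
    by (simp add: w_def)
qed

lemma schrodinger_cmult: "schrodinger \<tau> (\<lambda>x. c * f x) y = c * schrodinger \<tau> f y"
proof -
  have "fourier (\<lambda>x. c * f x) = (\<lambda>\<xi>. c * fourier f \<xi>)"
    by (simp add: fourier_def fun_eq_iff mult.left_commute[of _ c])
  then show ?thesis
    by (simp add: schrodinger_def mult.left_commute[of _ c])
qed

text \<open>The amplitude depends on time only, so that the Duhamel integral stays explicit. Its polynomial factor
  suppresses the forcing near the focus \<open>s\<^sub>0\<close>, its Gaussian factor localises the forcing in time. The
  values at time \<open>s\<^sub>0\<close> are not rescaled to height \<open>1\<close>, as the estimate is homogeneous.\<close>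

definition wave_packet :: "nat \<Rightarrow> real \<Rightarrow> real \<Rightarrow> real \<Rightarrow> (real ^ 'n) \<times> real \<Rightarrow> complex" where
  "wave_packet m b \<delta> s\<^sub>0 = (\<lambda>(x, s).
     of_real ((s - s\<^sub>0) ^ m * exp (- b * (s - s\<^sub>0)\<^sup>2)) * gauss_wave (Complex \<delta> (s - s\<^sub>0)) x)"

lemma duhamel_wave_packet:
  assumes "\<delta> > 0"
  shows "duhamel (wave_packet m b \<delta> s\<^sub>0) (x, t) =
    of_real (LBINT s=ereal 0..ereal t. (s - s\<^sub>0) ^ m * exp (- b * (s - s\<^sub>0)\<^sup>2)) *
      gauss_wave (Complex \<delta> (t - s\<^sub>0)) x"
proof -
  have "schrodinger (t - s) (\<lambda>y. wave_packet m b \<delta> s\<^sub>0 (y, s)) x =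
      of_real ((s - s\<^sub>0) ^ m * exp (- b * (s - s\<^sub>0)\<^sup>2)) * gauss_wave (Complex \<delta> (t - s\<^sub>0)) x" for s
  proof -
    have "Complex \<delta> (s - s\<^sub>0) + \<i> * of_real (t - s) = Complex \<delta> (t - s\<^sub>0)"
      by (simp add: complex_eq_iff)
    then show ?thesis
      using assms by (simp add: wave_packet_def schrodinger_cmult schrodinger_gauss_wave)
  qed
  then show ?thesis
    unfolding duhamel_def by (simp only: prod.case interval_lebesgue_integral_mult_left interval_lebesgue_integral_of_real)
qed

lemma norm_gauss_wave:
  fixes x :: "real ^ 'n"
  assumes "\<delta> > 0"
  shows "cmod (gauss_wave (Complex \<delta> \<sigma>) x) =
    cmod (Complex \<delta> \<sigma>) powr (- real CARD('n) / 2) * exp (- (\<delta> / (4 * (cmod (Complex \<delta> \<sigma>))\<^sup>2)) * (norm x)\<^sup>2)"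
proof -
  define Z where "Z = Complex \<delta> \<sigma>"
  have Z: "Z \<noteq> 0" "Re Z = \<delta>" using assms by (auto simp: Z_def complex_eq_iff)
  have "Re (- of_nat CARD('n) / 2 * Ln Z) = - real CARD('n) / 2 * ln (cmod Z)"
    using Z by simp
  moreover have "Re (of_real ((norm x)\<^sup>2) / (4 * Z)) = (\<delta> / (4 * (cmod Z)\<^sup>2)) * (norm x)\<^sup>2"
  proof -
    have "of_real ((norm x)\<^sup>2) / (4 * Z) = of_real ((norm x)\<^sup>2 / 4) * inverse Z"
      using Z by (simp add: field_simps)
    then show ?thesis
      by (simp add: Z cmod_power2 del: of_real_power of_real_divide)
  qed
  ultimately show ?thesis
    unfolding gauss_wave_def norm_exp_eq_Re Z_def[symmetric] minus_complex.sel
    using Z by (simp add: powr_def flip: exp_add)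
qed

section \<open>Wave packets are Schwartz functions\<close>

text \<open>An algebra of polynomially bounded functions that is closed under differentiation and contains the
  derivatives of the exponent of a wave packet and the polynomial factor of its amplitude.
  Hence every iterated derivative of a wave packet is a multiplier times the same exponential, and no
  formula for it is needed.\<close>

inductive multiplier :: "real \<Rightarrow> real \<Rightarrow> ('a::euclidean_space \<times> real \<Rightarrow> complex) \<Rightarrow> bool"
  for \<delta> s\<^sub>0 where
  const: "multiplier \<delta> s\<^sub>0 (\<lambda>p. c)"
| space: "multiplier \<delta> s\<^sub>0 (\<lambda>p. of_real (fst p \<bullet> u))"
| time: "multiplier \<delta> s\<^sub>0 (\<lambda>p. of_real (snd p - s\<^sub>0))"
| inverse: "multiplier \<delta> s\<^sub>0 (\<lambda>p. inverse (Complex \<delta> (snd p - s\<^sub>0)))"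
| add: "multiplier \<delta> s\<^sub>0 f \<Longrightarrow> multiplier \<delta> s\<^sub>0 g \<Longrightarrow> multiplier \<delta> s\<^sub>0 (\<lambda>p. f p + g p)"
| mult: "multiplier \<delta> s\<^sub>0 f \<Longrightarrow> multiplier \<delta> s\<^sub>0 g \<Longrightarrow> multiplier \<delta> s\<^sub>0 (\<lambda>p. f p * g p)"

lemma multiplier_minus: "multiplier \<delta> s\<^sub>0 f \<Longrightarrow> multiplier \<delta> s\<^sub>0 (\<lambda>p. - f p)"
  using multiplier.mult[OF multiplier.const[of \<delta> s\<^sub>0 "-1"], of f] by simp

lemma multiplier_diff: "multiplier \<delta> s\<^sub>0 f \<Longrightarrow> multiplier \<delta> s\<^sub>0 g \<Longrightarrow> multiplier \<delta> s\<^sub>0 (\<lambda>p. f p - g p)"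
  using multiplier.add[OF _ multiplier_minus, of \<delta> s\<^sub>0 f g] by simp

lemma multiplier_power: "multiplier \<delta> s\<^sub>0 f \<Longrightarrow> multiplier \<delta> s\<^sub>0 (\<lambda>p. f p ^ k)"
  by (induction k) (auto intro: multiplier.intros)

lemma multiplier_sum:
  "(\<And>i. i \<in> I \<Longrightarrow> multiplier \<delta> s\<^sub>0 (f i)) \<Longrightarrow> multiplier \<delta> s\<^sub>0 (\<lambda>p. \<Sum>i\<in>I. f i p)"
  by (induction I rule: infinite_finite_induct) (auto intro: multiplier.intros)

lemma multiplier_norm_sq: "multiplier \<delta> s\<^sub>0 (\<lambda>p. of_real ((norm (fst p))\<^sup>2))"
proof -
  have "of_real ((norm (fst p))\<^sup>2) = (\<Sum>b\<in>Basis. (of_real (fst p \<bullet> b))\<^sup>2 :: complex)" for p :: "'a \<times> real"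
    unfolding power2_norm_eq_inner by (subst euclidean_inner) (simp add: power2_eq_square)
  then show ?thesis
    by (simp only: multiplier_sum multiplier_power multiplier.space)
qed

lemmas multiplier_intros = multiplier.intros multiplier_minus multiplier_diff multiplier_power
  multiplier_norm_sq

lemma has_derivative_Complex_time:
  "((\<lambda>p::'a::euclidean_space \<times> real. Complex \<delta> (snd p - s\<^sub>0)) has_derivative (\<lambda>v. \<i> * of_real (snd v))) (at p)"
proof -
  have "Complex \<delta> (snd q - s\<^sub>0) = of_real \<delta> + \<i> * of_real (snd q - s\<^sub>0)" for q :: "'a \<times> real"
    by (simp add: complex_eq_iff)
  then show ?thesis
    by (auto intro!: derivative_eq_intros)
qed

lemma multiplier_has_derivative:
  assumes "\<delta> > 0" and "multiplier \<delta> s\<^sub>0 (m :: 'a::euclidean_space \<times> real \<Rightarrow> complex)"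
  shows "\<exists>D. (\<forall>p. (m has_derivative D p) (at p)) \<and> (\<forall>v. multiplier \<delta> s\<^sub>0 (\<lambda>p. D p v))"
  using assms(2)
proof induction
  case (const c)
  show ?case
    by (rule exI[of _ "\<lambda>_ _. 0"]) (auto intro: multiplier_intros)
next
  case (space u)
  show ?case
    by (rule exI[of _ "\<lambda>_ v. of_real (fst v \<bullet> u)"])
       (auto intro!: multiplier_intros derivative_eq_intros)
next
  case time
  show ?case
    by (rule exI[of _ "\<lambda>_ v. of_real (snd v)"])
       (auto intro!: multiplier_intros derivative_eq_intros)
next
  case inverse
  let ?Z = "\<lambda>p :: 'a \<times> real. Complex \<delta> (snd p - s\<^sub>0)"
  have nz: "?Z p \<noteq> 0" for p
    using assms(1) by (auto simp: complex_eq_iff)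
  show ?case
    by (rule exI[of _ "\<lambda>p v. - (inverse (?Z p) * (\<i> * of_real (snd v)) * inverse (?Z p))"])
       (intro conjI allI multiplier_intros Deriv.has_derivative_inverse nz has_derivative_Complex_time)
next
  case (add f g)
  then obtain D E where "\<And>p. (f has_derivative D p) (at p)" "\<And>v. multiplier \<delta> s\<^sub>0 (\<lambda>p. D p v)"
    "\<And>p. (g has_derivative E p) (at p)" "\<And>v. multiplier \<delta> s\<^sub>0 (\<lambda>p. E p v)" by blast
  then show ?case
    by (intro exI[of _ "\<lambda>p v. D p v + E p v"]) (auto intro!: multiplier_intros has_derivative_add)
next
  case (mult f g)
  then obtain D E where "\<And>p. (f has_derivative D p) (at p)" "\<And>v. multiplier \<delta> s\<^sub>0 (\<lambda>p. D p v)"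
    "\<And>p. (g has_derivative E p) (at p)" "\<And>v. multiplier \<delta> s\<^sub>0 (\<lambda>p. E p v)" by blast
  with mult.hyps show ?case
    by (intro exI[of _ "\<lambda>p v. f p * E p v + D p v * g p"]) (auto intro!: multiplier_intros has_derivative_mult)
qed

lemma multiplier_poly_bound:
  assumes "\<delta> > 0" and "multiplier \<delta> s\<^sub>0 (m :: 'a::euclidean_space \<times> real \<Rightarrow> complex)"
  shows "\<exists>K N. K \<ge> 0 \<and> (\<forall>p. cmod (m p) \<le> K * (1 + norm p) ^ N)"
  using assms(2)
proof induction
  case (const c)
  show ?case
    by (rule exI[of _ "cmod c"], rule exI[of _ 0]) auto
next
  case (space u)
  have "cmod (of_real (fst p \<bullet> u)) \<le> norm u * (1 + norm p) ^ 1" for p :: "'a \<times> real"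
  proof -
    have "cmod (of_real (fst p \<bullet> u)) \<le> norm (fst p) * norm u"
      by (simp add: Cauchy_Schwarz_ineq2)
    also have "\<dots> \<le> norm u * (1 + norm p)"
      using norm_fst_le[of "fst p" "snd p"] by (simp add: mult.commute mult_left_mono)
    finally show ?thesis by simp
  qed
  then show ?case
    using norm_ge_zero by blast
next
  case time
  have "cmod (of_real (snd p - s\<^sub>0)) \<le> (1 + \<bar>s\<^sub>0\<bar>) * (1 + norm p) ^ 1" for p :: "'a \<times> real"
  proof -
    have "\<bar>snd p\<bar> \<le> norm p"
      using norm_snd_le[of "snd p" "fst p"] by simp
    then have "\<bar>snd p - s\<^sub>0\<bar> \<le> norm p + \<bar>s\<^sub>0\<bar>" by linarith
    also have "\<dots> \<le> (1 + \<bar>s\<^sub>0\<bar>) * (1 + norm p)" by (simp add: algebra_simps)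
    finally show ?thesis by (simp only: norm_of_real power_one_right)
  qed
  then show ?case
    by (intro exI[of _ "1 + \<bar>s\<^sub>0\<bar>"] exI[of _ 1]) auto
next
  case inverse
  have "cmod (inverse (Complex \<delta> (snd p - s\<^sub>0))) \<le> 1 / \<delta> * (1 + norm p) ^ 0" for p :: "'a \<times> real"
    using assms(1) abs_Re_le_cmod[of "Complex \<delta> (snd p - s\<^sub>0)"]
    by (auto simp: norm_inverse inverse_eq_divide norm_divide intro!: divide_left_mono mult_pos_pos)
  then show ?case
    using assms(1) by (intro exI[of _ "1 / \<delta>"] exI[of _ 0]) auto
next
  case (add f g)
  then obtain K N L M where f: "K \<ge> 0" "\<And>p. cmod (f p) \<le> K * (1 + norm p) ^ N"
    and g: "L \<ge> 0" "\<And>p. cmod (g p) \<le> L * (1 + norm p) ^ M" by blast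
  have "cmod (f p + g p) \<le> (K + L) * (1 + norm p) ^ (N + M)" for p
  proof -
    have "cmod (f p + g p) \<le> K * (1 + norm p) ^ N + L * (1 + norm p) ^ M"
      using norm_triangle_ineq[of "f p" "g p"] f(2)[of p] g(2)[of p] by linarith
    also have "\<dots> \<le> K * (1 + norm p) ^ (N + M) + L * (1 + norm p) ^ (N + M)"
      using f(1) g(1) by (intro add_mono mult_left_mono power_increasing) auto
    finally show ?thesis by (simp add: algebra_simps)
  qed
  then show ?case
    using f(1) g(1) by (intro exI[of _ "K + L"] exI[of _ "N + M"]) auto
next
  case (mult f g)
  then obtain K N L M where f: "K \<ge> 0" "\<And>p. cmod (f p) \<le> K * (1 + norm p) ^ N"
    and g: "L \<ge> 0" "\<And>p. cmod (g p) \<le> L * (1 + norm p) ^ M" by blast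
  have "cmod (f p * g p) \<le> (K * L) * (1 + norm p) ^ (N + M)" for p
  proof -
    have "cmod (f p * g p) \<le> (K * (1 + norm p) ^ N) * (L * (1 + norm p) ^ M)"
      using f(1) unfolding norm_mult by (intro mult_mono f g) auto
    then show ?thesis by (simp add: power_add mult_ac)
  qed
  then show ?case
    using f(1) g(1) by (intro exI[of _ "K * L"] exI[of _ "N + M"]) auto
qed

lemma schwartz_multiplier_exp:
  fixes \<Psi> :: "'a::euclidean_space \<times> real \<Rightarrow> complex"
  assumes "\<delta> > 0" and m: "multiplier \<delta> s\<^sub>0 m"
    and \<Psi>: "\<And>p. (\<Psi> has_derivative E p) (at p)" and E: "\<And>v. multiplier \<delta> s\<^sub>0 (\<lambda>p. E p v)"
    and decay: "\<And>N. \<exists>M. \<forall>p. (1 + norm p) ^ N * exp (Re (\<Psi> p)) \<le> M"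
  shows "schwartz (\<lambda>p. m p * exp (\<Psi> p))"
proof -
  have step: "\<exists>D. (\<forall>p. ((\<lambda>p. f p * exp (\<Psi> p)) has_derivative D p) (at p)) \<and>
      (\<forall>v. \<exists>g. multiplier \<delta> s\<^sub>0 g \<and> (\<forall>p. D p v = g p * exp (\<Psi> p)))"
    if f: "multiplier \<delta> s\<^sub>0 f" for f
  proof -
    obtain D where D: "\<And>p. (f has_derivative D p) (at p)" "\<And>v. multiplier \<delta> s\<^sub>0 (\<lambda>p. D p v)"
      using multiplier_has_derivative[OF assms(1) f] by blast
    have "((\<lambda>p. f p * exp (\<Psi> p)) has_derivative
        (\<lambda>v. f p * (exp (\<Psi> p) * E p v) + D p v * exp (\<Psi> p))) (at p)" for p
      by (intro has_derivative_mult D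
            has_derivative_compose[OF \<Psi> has_field_derivative_imp_has_derivative[OF DERIV_exp]])
    moreover have "f p * (exp (\<Psi> p) * E p v) + D p v * exp (\<Psi> p) = (f p * E p v + D p v) * exp (\<Psi> p)" for p v
      by (simp add: algebra_simps)
    moreover have "multiplier \<delta> s\<^sub>0 (\<lambda>p. f p * E p v + D p v)" for v
      by (intro multiplier_intros f E D)
    ultimately show ?thesis
      by (intro exI[of _ "\<lambda>p v. f p * (exp (\<Psi> p) * E p v) + D p v * exp (\<Psi> p)"]) blast
  qed
  have iter: "\<exists>g. multiplier \<delta> s\<^sub>0 g \<and> iterated_deriv vs (\<lambda>p. m p * exp (\<Psi> p)) = (\<lambda>p. g p * exp (\<Psi> p))" for vs
  proof (induction vs)
    case Nil
    show ?case using m by auto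
  next
    case (Cons v vs)
    then obtain g where g: "multiplier \<delta> s\<^sub>0 g"
      "iterated_deriv vs (\<lambda>p. m p * exp (\<Psi> p)) = (\<lambda>p. g p * exp (\<Psi> p))" by blast
    obtain D h where D: "\<And>p. ((\<lambda>p. g p * exp (\<Psi> p)) has_derivative D p) (at p)"
      and h: "multiplier \<delta> s\<^sub>0 h" "\<And>p. D p v = h p * exp (\<Psi> p)"
      using step[OF g(1)] by blast
    have "frechet_derivative (\<lambda>p. g p * exp (\<Psi> p)) (at p) = D p" for p
      using frechet_derivative_at[OF D] by simp
    then show ?case
      using g h by auto
  qed
  show ?thesis
    unfolding schwartz_def
  proof (intro allI impI conjI)
    fix vs :: "('a \<times> real) list"
    obtain g where g: "multiplier \<delta> s\<^sub>0 g"
      and eq: "iterated_deriv vs (\<lambda>p. m p * exp (\<Psi> p)) = (\<lambda>p. g p * exp (\<Psi> p))"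
      using iter by blast
    show "iterated_deriv vs (\<lambda>p. m p * exp (\<Psi> p)) differentiable_on UNIV"
      using step[OF g] unfolding eq differentiable_on_def differentiable_def by auto
    fix k
    obtain K N where K: "K \<ge> 0" "\<And>p. cmod (g p) \<le> K * (1 + norm p) ^ N"
      using multiplier_poly_bound[OF assms(1) g] by blast
    obtain M where M: "\<And>p. (1 + norm p) ^ (k + N) * exp (Re (\<Psi> p)) \<le> M"
      using decay by blast
    have "norm (norm p ^ k *\<^sub>R (g p * exp (\<Psi> p))) \<le> K * M" for p
    proof -
      have "norm (norm p ^ k *\<^sub>R (g p * exp (\<Psi> p))) = norm p ^ k * (cmod (g p) * exp (Re (\<Psi> p)))"
        by (simp add: norm_mult)
      also have "\<dots> \<le> (1 + norm p) ^ k * ((K * (1 + norm p) ^ N) * exp (Re (\<Psi> p)))"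
        using K by (intro mult_mono power_mono) auto
      also have "\<dots> = K * ((1 + norm p) ^ (k + N) * exp (Re (\<Psi> p)))"
        by (simp add: power_add mult_ac)
      also have "\<dots> \<le> K * M"
        using M K(1) by (intro mult_left_mono)
      finally show ?thesis .
    qed
    then show "bounded (range (\<lambda>p. norm p ^ k *\<^sub>R iterated_deriv vs (\<lambda>p. m p * exp (\<Psi> p)) p))"
      unfolding eq bounded_iff by blast
  qed
qed

text \<open>Compare \<open>1 + t\<close> with a multiple of \<open>exp (b t / (N + 1))\<close>; using \<open>N + 1\<close> instead of \<open>N\<close>
  avoids a case distinction for \<open>N = 0\<close>.\<close>

lemma poly_exp_bounded:
  fixes b :: real
  assumes "b > 0"
  shows "\<exists>M. \<forall>t\<ge>0. (1 + t) ^ N * exp (- b * t) \<le> M"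
proof (intro exI allI impI)
  fix t :: real assume t: "t \<ge> 0"
  define c where "c = max 1 (real (Suc N) / b)"
  have c: "c \<ge> 1" "c * b \<ge> real (Suc N)"
    using assms by (auto simp: c_def max_def field_simps)
  have "1 + t \<le> c * (1 + b * t / real (Suc N))"
  proof -
    have "c * (1 + b * t / real (Suc N)) = c + (c * b) / real (Suc N) * t" by (simp add: algebra_simps)
    moreover have "t \<le> (c * b) / real (Suc N) * t"
      using mult_right_mono[OF c(2) t] by (simp add: field_simps)
    ultimately show ?thesis using c(1) by linarith
  qed
  also have "\<dots> \<le> c * exp (b * t / real (Suc N))"
    using c(1) by (intro mult_left_mono exp_ge_add_one_self) auto
  finally have "(1 + t) ^ N \<le> (c * exp (b * t / real (Suc N))) ^ N"
    using t by (intro power_mono) auto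
  also have "\<dots> = c ^ N * exp (b * t * (real N / real (Suc N)))"
    by (simp add: power_mult_distrib mult.commute flip: exp_of_nat_mult)
  also have "\<dots> \<le> c ^ N * exp (b * t * 1)"
    using assms t c(1) by (intro mult_left_mono) (auto intro!: mult_left_mono simp: divide_le_eq)
  finally have "(1 + t) ^ N * exp (- b * t) \<le> (c ^ N * exp (b * t * 1)) * exp (- b * t)"
    by (rule mult_right_mono) simp
  also have "\<dots> = c ^ N"
    by (simp add: exp_minus)
  finally show "(1 + t) ^ N * exp (- b * t) \<le> max 1 (real (Suc N) / b) ^ N"
    by (simp add: c_def)
qed

text \<open>The spatial decay degenerates as time grows, because the packet spreads. In terms of
  \<open>\<sigma> = snd p - s\<^sub>0\<close> and the spatial exponent \<open>y\<close>, however, \<open>1 + norm p\<close> is at most a multiple of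
  \<open>(1 + \<sigma>\<^sup>2) (1 + y)\<close>, and the two factors are controlled by \<open>exp (-b \<sigma>\<^sup>2)\<close> and \<open>exp (-y)\<close>.\<close>

lemma gauss_wave_phase_decay:
  assumes "\<delta> > 0" and "b > 0" and "a \<ge> 0"
  shows "\<exists>M. \<forall>p :: 'a::euclidean_space \<times> real. (1 + norm p) ^ N *
    exp (- b * (snd p - s\<^sub>0)\<^sup>2 - a * ln (cmod (Complex \<delta> (snd p - s\<^sub>0))) -
      \<delta> / (4 * (cmod (Complex \<delta> (snd p - s\<^sub>0)))\<^sup>2) * (norm (fst p))\<^sup>2) \<le> M"
proof -
  obtain M\<^sub>1 where M1: "\<And>t. t \<ge> 0 \<Longrightarrow> (1 + t) ^ N * exp (- b * t) \<le> M\<^sub>1"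
    using poly_exp_bounded[OF assms(2)] by blast
  obtain M\<^sub>2 where M2: "\<And>t::real. t \<ge> 0 \<Longrightarrow> (1 + t) ^ N * exp (- 1 * t) \<le> M\<^sub>2"
    using poly_exp_bounded[OF zero_less_one, of N] by blast
  have M20: "M\<^sub>2 \<ge> 0" using M2[of 0] by simp
  define K where "K = 3 + \<bar>s\<^sub>0\<bar> + 4 / \<delta> * (\<delta>\<^sup>2 + 1)"
  have K0: "K \<ge> 0" using assms(1) by (simp add: K_def)
  have "(1 + norm p) ^ N * exp (- b * (snd p - s\<^sub>0)\<^sup>2 - a * ln (cmod (Complex \<delta> (snd p - s\<^sub>0))) -
      \<delta> / (4 * (cmod (Complex \<delta> (snd p - s\<^sub>0)))\<^sup>2) * (norm (fst p))\<^sup>2)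
      \<le> K ^ N * exp (- a * ln \<delta>) * (M\<^sub>1 * M\<^sub>2)" for p :: "'a \<times> real"
  proof -
    define \<sigma> where "\<sigma> = snd p - s\<^sub>0"
    define Z where "Z = cmod (Complex \<delta> \<sigma>)"
    define y where "y = \<delta> / (4 * Z\<^sup>2) * (norm (fst p))\<^sup>2"
    have Z: "Z\<^sup>2 = \<delta>\<^sup>2 + \<sigma>\<^sup>2" "\<delta> \<le> Z"
      using abs_Re_le_cmod[of "Complex \<delta> \<sigma>"] assms(1) by (auto simp: Z_def cmod_power2)
    have y0: "y \<ge> 0" using assms(1) by (simp add: y_def)
    have x: "(norm (fst p))\<^sup>2 = 4 / \<delta> * (\<delta>\<^sup>2 + \<sigma>\<^sup>2) * y"
    proof -
      have "Z > 0" using Z(2) assms(1) by linarith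
      then show ?thesis
        unfolding Z(1)[symmetric] y_def using assms(1) by (simp add: field_simps)
    qed
    have sq: "u \<le> 1 + u\<^sup>2" for u :: real
    proof -
      have "2 * u \<le> u\<^sup>2 + 1"
        using zero_le_power2[of "u - 1"] by (simp add: power2_diff)
      then show ?thesis
        using zero_le_power2[of u] by linarith
    qed
    have "norm p \<le> norm (fst p) + \<bar>snd p\<bar>"
      using norm_Pair_le[of "fst p" "snd p"] by simp
    also have "\<bar>snd p\<bar> \<le> \<bar>\<sigma>\<bar> + \<bar>s\<^sub>0\<bar>" by (simp add: \<sigma>_def)
    also have "norm (fst p) + (\<bar>\<sigma>\<bar> + \<bar>s\<^sub>0\<bar>) \<le> (1 + (norm (fst p))\<^sup>2) + ((1 + \<sigma>\<^sup>2) + \<bar>s\<^sub>0\<bar>)"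
      using sq[of "norm (fst p)"] sq[of "\<bar>\<sigma>\<bar>"] by simp
    finally have "1 + norm p \<le> (3 + \<bar>s\<^sub>0\<bar> + \<sigma>\<^sup>2) + 4 / \<delta> * (\<delta>\<^sup>2 + \<sigma>\<^sup>2) * y"
      unfolding x by simp
    also have "\<dots> \<le> (3 + \<bar>s\<^sub>0\<bar>) * ((1 + \<sigma>\<^sup>2) * (1 + y)) + 4 / \<delta> * ((\<delta>\<^sup>2 + 1) * (1 + \<sigma>\<^sup>2)) * (1 + y)"
    proof (intro add_mono)
      have "3 + \<bar>s\<^sub>0\<bar> + \<sigma>\<^sup>2 \<le> (3 + \<bar>s\<^sub>0\<bar>) * (1 + \<sigma>\<^sup>2)"
        by (simp add: algebra_simps)
      also have "\<dots> \<le> (3 + \<bar>s\<^sub>0\<bar>) * ((1 + \<sigma>\<^sup>2) * (1 + y))"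
        using y0 by (intro mult_left_mono) (auto simp: algebra_simps)
      finally show "3 + \<bar>s\<^sub>0\<bar> + \<sigma>\<^sup>2 \<le> (3 + \<bar>s\<^sub>0\<bar>) * ((1 + \<sigma>\<^sup>2) * (1 + y))" .
      have "\<delta>\<^sup>2 + \<sigma>\<^sup>2 \<le> (\<delta>\<^sup>2 + 1) * (1 + \<sigma>\<^sup>2)" by (simp add: algebra_simps)
      then show "4 / \<delta> * (\<delta>\<^sup>2 + \<sigma>\<^sup>2) * y \<le> 4 / \<delta> * ((\<delta>\<^sup>2 + 1) * (1 + \<sigma>\<^sup>2)) * (1 + y)"
        using assms(1) y0 by (intro mult_mono) auto
    qed
    also have "\<dots> = K * ((1 + \<sigma>\<^sup>2) * (1 + y))"
      by (simp only: K_def distrib_right mult.assoc)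
    finally have "(1 + norm p) ^ N \<le> (K * ((1 + \<sigma>\<^sup>2) * (1 + y))) ^ N"
      by (intro power_mono) auto
    then have P: "(1 + norm p) ^ N \<le> K ^ N * ((1 + \<sigma>\<^sup>2) ^ N * (1 + y) ^ N)"
      by (simp only: power_mult_distrib)
    have L: "exp (- b * \<sigma>\<^sup>2 - a * ln Z - y) \<le> exp (- a * ln \<delta>) * (exp (- b * \<sigma>\<^sup>2) * exp (- 1 * y))"
      using Z(2) assms(1,3) by (simp add: mult_left_mono flip: exp_add)
    have "(1 + norm p) ^ N * exp (- b * \<sigma>\<^sup>2 - a * ln Z - y)
        \<le> (K ^ N * ((1 + \<sigma>\<^sup>2) ^ N * (1 + y) ^ N)) * (exp (- a * ln \<delta>) * (exp (- b * \<sigma>\<^sup>2) * exp (- 1 * y)))"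
      using K0 y0 by (intro mult_mono P L) auto
    also have "\<dots> = K ^ N * exp (- a * ln \<delta>) *
        (((1 + \<sigma>\<^sup>2) ^ N * exp (- b * \<sigma>\<^sup>2)) * ((1 + y) ^ N * exp (- 1 * y)))"
      by (simp only: mult_ac)
    also have "\<dots> \<le> K ^ N * exp (- a * ln \<delta>) * (M\<^sub>1 * M\<^sub>2)"
      using K0 y0 M20 by (intro mult_left_mono mult_mono' M1 M2) auto
    finally show ?thesis
      by (simp only: \<sigma>_def Z_def y_def)
  qed
  then show ?thesis by blast
qed

lemma schwartz_wave_packet:
  assumes "\<delta> > 0" and "b > 0"
  shows "schwartz (wave_packet m b \<delta> s\<^sub>0 :: (real ^ 'n) \<times> real \<Rightarrow> complex)"
proof -
  define n where "n = CARD('n)"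
  let ?Z = "\<lambda>p :: (real ^ 'n) \<times> real. Complex \<delta> (snd p - s\<^sub>0)"
  have nz: "?Z p \<noteq> 0" "?Z p \<notin> \<real>\<^sub>\<le>\<^sub>0" for p
    using assms(1) by (auto simp: complex_eq_iff complex_nonpos_Reals_iff)
  define \<Psi> where "\<Psi> = (\<lambda>p. - of_real b * (of_real (snd p - s\<^sub>0))\<^sup>2 - of_nat n / 2 * Ln (?Z p)
    - (\<Sum>i\<in>Basis. (of_real (fst p \<bullet> i))\<^sup>2) * (1 / 4 * inverse (?Z p)))"
  have nsq: "(\<Sum>i\<in>Basis. (of_real (x \<bullet> i))\<^sup>2) = complex_of_real ((norm x)\<^sup>2)" for x :: "real ^ 'n"
    unfolding power2_norm_eq_inner euclidean_inner[of x x] by (simp add: power2_eq_square)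
  have eq: "wave_packet m b \<delta> s\<^sub>0 = (\<lambda>p. (of_real (snd p - s\<^sub>0)) ^ m * exp (\<Psi> p))"
  proof
    fix p :: "(real ^ 'n) \<times> real"
    have "of_real ((norm (fst p))\<^sup>2) / (4 * ?Z p) = of_real ((norm (fst p))\<^sup>2) * (1 / 4 * inverse (?Z p))"
      using nz(1)[of p] by (simp add: field_simps)
    moreover have "complex_of_real (exp (- b * (snd p - s\<^sub>0)\<^sup>2)) = exp (- of_real b * (of_real (snd p - s\<^sub>0))\<^sup>2)"
      by (simp flip: exp_of_real)
    ultimately have "complex_of_real (exp (- b * (snd p - s\<^sub>0)\<^sup>2)) * gauss_wave (?Z p) (fst p) = exp (\<Psi> p)"
      by (simp only: gauss_wave_def \<Psi>_def nsq n_def exp_add[symmetric] add_diff_eq)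
         (simp only: mult_minus_left divide_minus_left diff_conv_add_uminus minus_add_distrib add.assoc)
    then show "wave_packet m b \<delta> s\<^sub>0 p = (of_real (snd p - s\<^sub>0)) ^ m * exp (\<Psi> p)"
      by (simp add: wave_packet_def case_prod_beta mult.assoc)
  qed
  define E where "E = (\<lambda>p v. - of_real b * (2 * of_real (snd p - s\<^sub>0) * of_real (snd v))
    - of_nat n / 2 * (inverse (?Z p) * (\<i> * of_real (snd v)))
    - ((\<Sum>i\<in>Basis. (of_real (fst p \<bullet> i))\<^sup>2) * (1 / 4 * - (inverse (?Z p) * (\<i> * of_real (snd v)) * inverse (?Z p)))
      + (\<Sum>i\<in>Basis. 2 * of_real (fst p \<bullet> i) * of_real (fst v \<bullet> i)) * (1 / 4 * inverse (?Z p))))"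
  have Ln': "((\<lambda>p. Ln (?Z p)) has_derivative (\<lambda>v. inverse (?Z p) * (\<i> * of_real (snd v)))) (at p)" for p
    using has_derivative_compose[OF has_derivative_Complex_time has_field_derivative_imp_has_derivative[OF has_field_derivative_Ln[OF nz(2)]]] .
  have sq': "((\<lambda>p. (f p)\<^sup>2) has_derivative (\<lambda>v. 2 * f p * f' v)) (at p)"
    if "(f has_derivative f') (at p)" for f :: "(real ^ 'n) \<times> real \<Rightarrow> complex" and f' p
    using that by (auto intro!: derivative_eq_intros simp: fun_eq_iff)
  have time': "((\<lambda>p. complex_of_real (snd p - s\<^sub>0)) has_derivative (\<lambda>v. of_real (snd v))) (at p)"
    for p :: "(real ^ 'n) \<times> real"
    by (auto intro!: derivative_eq_intros)
  have space': "((\<lambda>p. complex_of_real (fst p \<bullet> i)) has_derivative (\<lambda>v. of_real (fst v \<bullet> i))) (at p)"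
    for i and p :: "(real ^ 'n) \<times> real"
    by (auto intro!: derivative_eq_intros)
  have \<Psi>': "(\<Psi> has_derivative E p) (at p)" for p
    unfolding \<Psi>_def E_def
    by (rule has_derivative_diff[OF has_derivative_diff[OF has_derivative_mult_right[OF sq'[OF time']]
          has_derivative_mult_right[OF Ln']] has_derivative_mult[OF has_derivative_sum[OF sq'[OF space']]
          has_derivative_mult_right[OF Deriv.has_derivative_inverse[OF nz(1) has_derivative_Complex_time]]]])
  have E: "multiplier \<delta> s\<^sub>0 (\<lambda>p. E p v)" for v
    unfolding E_def by (intro multiplier_intros multiplier_sum)
  have decay: "\<exists>M. \<forall>p. (1 + norm p) ^ N * exp (Re (\<Psi> p)) \<le> M" for N
  proof -
    have "Re (\<Psi> p) = - b * (snd p - s\<^sub>0)\<^sup>2 - (real n / 2) * ln (cmod (?Z p)) -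
      \<delta> / (4 * (cmod (?Z p))\<^sup>2) * (norm (fst p))\<^sup>2" for p
      unfolding \<Psi>_def nsq using nz(1)[of p] by (simp add: cmod_power2 mult.commute)
    then show ?thesis
      using gauss_wave_phase_decay[OF assms, of "real n / 2" N s\<^sub>0, where 'a = "real ^ 'n"] by simp
  qed
  show ?thesis
    unfolding eq
    by (rule schwartz_multiplier_exp[OF assms(1) multiplier_power[OF multiplier.time] \<Psi>' E decay])
qed

section \<open>Lebesgue norms of Gaussians\<close>

lemma ennreal_powr_ennreal: "x \<ge> 0 \<Longrightarrow> ennreal_powr (ennreal x) a = ennreal (x powr a)"
  by (simp add: ennreal_powr_def)

lemma ennreal_powr_mono:
  assumes "x \<le> y" and "a > 0"
  shows "ennreal_powr x a \<le> ennreal_powr y a"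
proof (cases y)
  case (real r)
  then obtain s where "x = ennreal s" "0 \<le> s" "s \<le> r"
    using assms(1) by (cases x) (auto simp: top_unique)
  with real assms(2) show ?thesis
    by (simp add: ennreal_powr_ennreal ennreal_leI powr_mono2)
qed (simp add: ennreal_powr_def)

lemma exponent_cases [case_names finite infinity]:
  assumes "1 \<le> p"
  obtains (finite) P where "p = ennreal P" "P \<ge> 1" "enn2real p = P" "recip_exponent p = 1 / P" "p \<noteq> \<infinity>"
  | (infinity) "p = \<infinity>" "recip_exponent p = 0"
proof (cases p)
  case (real P)
  then have P: "P \<ge> 1" using assms by simp
  have "1 / p = ennreal (1 / P)"
    using P real divide_ennreal[of 1 P] by simp
  then have "recip_exponent p = 1 / P"
    using P by (simp add: recip_exponent_def)
  then show thesis
    using that(1)[of P] real P by simp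
next
  case top
  then show thesis
    using that(2) by (simp add: recip_exponent_def)
qed

lemma recip_exponent_bounds:
  assumes "1 \<le> p"
  shows "0 \<le> recip_exponent p" and "recip_exponent p \<le> 1"
  using assms by (cases p rule: exponent_cases; simp)+

text \<open>Measurability of the smaller function matters for \<open>p = \<infinity>\<close>: the essential supremum of a
  non-measurable function is \<open>\<infinity>\<close> by convention.\<close>

lemma Lp_norm_mono:
  assumes "1 \<le> p" and "f \<in> borel_measurable M" and "\<And>x. f x \<le> g x"
  shows "Lp_norm M p f \<le> Lp_norm M p g"
  using assms(1)
proof (cases p rule: exponent_cases)
  case (finite P)
  then show ?thesis
    using assms(3) by (auto simp: Lp_norm_def intro!: ennreal_powr_mono nn_integral_mono)
next
  case infinity
  then show ?thesis
    using assms(2,3) by (auto simp: Lp_norm_def intro: esssup_mono)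
qed

lemma Lp_norm_lower_bound:
  assumes p: "1 \<le> p" and S: "S \<in> sets M" "emeasure M S = ennreal \<mu>" "\<mu> > 0"
    and c: "c > 0" and g: "\<And>x. x \<in> S \<Longrightarrow> ennreal c \<le> g x"
  shows "ennreal (c * \<mu> powr recip_exponent p) \<le> Lp_norm M p g"
  using p
proof (cases p rule: exponent_cases)
  case (finite P)
  have "ennreal (c powr P * \<mu>) = (\<integral>\<^sup>+x. ennreal (c powr P) * indicator S x \<partial>M)"
    using S by (simp add: nn_integral_cmult_indicator ennreal_mult')
  also have "\<dots> \<le> (\<integral>\<^sup>+x. ennreal_powr (g x) P \<partial>M)"
  proof (rule nn_integral_mono)
    fix x
    show "ennreal (c powr P) * indicator S x \<le> ennreal_powr (g x) P"
      using ennreal_powr_mono[OF g, of x P] finite(2) c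
      by (auto simp: ennreal_powr_ennreal split: split_indicator)
  qed
  finally have "ennreal_powr (ennreal (c powr P * \<mu>)) (1 / P) \<le> Lp_norm M p g"
    using finite by (auto simp: Lp_norm_def intro!: ennreal_powr_mono)
  moreover have "(c powr P * \<mu>) powr (1 / P) = c * \<mu> powr recip_exponent p"
    using finite c S(3) by (simp add: powr_mult powr_powr)
  ultimately show ?thesis
    using c S(3) by (simp add: ennreal_powr_ennreal)
next
  case infinity
  have "ennreal c \<le> esssup M g"
  proof (rule ccontr)
    assume "\<not> ennreal c \<le> esssup M g"
    then have less: "esssup M g < ennreal c" by simp
    have "AE x in M. x \<notin> S"
      using esssup_AE[of g M]
    proof eventually_elim
      case (elim x)
      then show ?case using less g[of x] by (meson leD le_less_trans order_trans)
    qed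
    then have "S \<in> null_sets M"
      using S(1) by (simp add: AE_iff_null_sets)
    then show False using null_setsD1[of S M] S(2,3) by simp
  qed
  then show ?thesis
    using infinity S(3) by (simp add: Lp_norm_def)
qed

lemma nn_integral_gaussian:
  fixes x\<^sub>0 :: "'a::euclidean_space"
  assumes "\<beta> > 0"
  shows "(\<integral>\<^sup>+x. ennreal (exp (- \<beta> * (norm (x - x\<^sub>0))\<^sup>2)) \<partial>lborel) = ennreal ((pi / \<beta>) powr (real DIM('a) / 2))"
proof -
  have "(\<integral>\<^sup>+x. ennreal (exp (- \<beta> * (norm (x - x\<^sub>0))\<^sup>2)) \<partial>lborel) =
      (\<integral>\<^sup>+x. ennreal (exp (- \<beta> * (norm (x - x\<^sub>0))\<^sup>2)) \<partial>(distr lborel borel ((+) x\<^sub>0) :: 'a measure))"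
    by (simp add: lborel_distr_plus)
  also have "\<dots> = (\<integral>\<^sup>+x. ennreal (exp (- \<beta> * (norm x)\<^sup>2)) \<partial>(lborel :: 'a measure))"
    by (subst nn_integral_distr) auto
  also have "\<dots> = ennreal ((pi / \<beta>) powr (real DIM('a) / 2))"
  proof -
    note G = complex_gaussian_fourier[of "of_real \<beta>" "0::'a"]
    have eq: "exp (- of_real \<beta> * of_real ((norm x)\<^sup>2)) = complex_of_real (exp (- \<beta> * (norm x)\<^sup>2))" for x :: 'a
      by (simp flip: exp_of_real)
    have int: "integrable lborel (\<lambda>x :: 'a. complex_of_real (exp (- \<beta> * (norm x)\<^sup>2)))"
      using G(1) assms by (simp only: eq inner_zero_left cis_zero mult_1_left) simp
    have "complex_of_real (\<integral>x. exp (- \<beta> * (norm x)\<^sup>2) \<partial>(lborel :: 'a measure)) =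
        of_real (sqrt pi ^ DIM('a)) * exp (- of_nat DIM('a) / 2 * Ln (of_real \<beta>))"
      using G(2) assms by (simp only: eq inner_zero_left cis_zero mult_1_left integral_complex_of_real) simp
    also have "- of_nat DIM('a) / 2 * Ln (of_real \<beta>) = complex_of_real (- real DIM('a) / 2 * ln \<beta>)"
      using assms by (simp add: Ln_of_real)
    also have "of_real (sqrt pi ^ DIM('a)) * exp (complex_of_real (- real DIM('a) / 2 * ln \<beta>)) =
        complex_of_real (sqrt pi ^ DIM('a) * exp (- real DIM('a) / 2 * ln \<beta>))"
      by (subst exp_of_real) (simp only: of_real_mult)
    finally have "(\<integral>x. exp (- \<beta> * (norm x)\<^sup>2) \<partial>(lborel :: 'a measure)) = sqrt pi ^ DIM('a) * exp (- real DIM('a) / 2 * ln \<beta>)"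
      by (simp only: of_real_eq_iff)
    also have "sqrt pi ^ DIM('a) = pi powr (real DIM('a) / 2)"
      by (simp add: powr_half_sqrt[symmetric] powr_powr flip: powr_realpow)
    also have "exp (- real DIM('a) / 2 * ln \<beta>) = \<beta> powr (- real DIM('a) / 2)"
      using assms by (simp add: powr_def)
    also have "pi powr (real DIM('a) / 2) * \<beta> powr (- real DIM('a) / 2) = (pi / \<beta>) powr (real DIM('a) / 2)"
      using assms by (simp add: powr_divide powr_minus_divide)
    finally show ?thesis
      using int by (subst nn_integral_eq_integral) (auto simp: complex_of_real_integrable_eq)
  qed
  finally show ?thesis .
qed

text \<open>Only the scaling in \<open>c\<close> and \<open>\<beta>\<close> matters below, so the constant is left unspecified; it is uniform in
  the centre. An exact value, rather than an upper bound, also shows that the norm of a wave packet over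
  space is a measurable function of time.\<close>

lemma Lp_norm_gaussian:
  assumes p: "1 \<le> p"
  obtains G where "G > 0"
    "\<And>c \<beta> (x\<^sub>0 :: 'a::euclidean_space). c \<ge> 0 \<Longrightarrow> \<beta> > 0 \<Longrightarrow>
      Lp_norm lborel p (\<lambda>x. ennreal (c * exp (- \<beta> * (norm (x - x\<^sub>0))\<^sup>2))) =
        ennreal (G * c * \<beta> powr (- real DIM('a) / 2 * recip_exponent p))"
  using p
proof (cases p rule: exponent_cases)
  case (finite P)
  show thesis
  proof (rule that[of "(pi / P) powr (real DIM('a) / 2 * (1 / P))"])
    show "(pi / P) powr (real DIM('a) / 2 * (1 / P)) > 0" using finite(2) by simp
    fix c \<beta> :: real and x\<^sub>0 :: 'a
    assume c: "c \<ge> 0" and \<beta>: "\<beta> > 0"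
    have "ennreal_powr (ennreal (c * exp (- \<beta> * (norm (x - x\<^sub>0))\<^sup>2))) P =
        ennreal (c powr P) * ennreal (exp (- (P * \<beta>) * (norm (x - x\<^sub>0))\<^sup>2))" for x
    proof -
      have "(c * exp (- \<beta> * (norm (x - x\<^sub>0))\<^sup>2)) powr P = c powr P * exp (- (P * \<beta>) * (norm (x - x\<^sub>0))\<^sup>2)"
        using c by (simp add: powr_mult exp_powr_real mult_ac)
      then show ?thesis
        using c by (subst ennreal_powr_ennreal) (simp_all add: ennreal_mult')
    qed
    then have "Lp_norm lborel p (\<lambda>x. ennreal (c * exp (- \<beta> * (norm (x - x\<^sub>0))\<^sup>2))) =
        ennreal_powr (ennreal (c powr P) * (\<integral>\<^sup>+x. ennreal (exp (- (P * \<beta>) * (norm (x - x\<^sub>0))\<^sup>2)) \<partial>lborel)) (1 / P)"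
      using finite by (simp add: Lp_norm_def nn_integral_cmult)
    also have "\<dots> = ennreal ((c powr P * (pi / (P * \<beta>)) powr (real DIM('a) / 2)) powr (1 / P))"
      using finite(2) \<beta> by (subst nn_integral_gaussian) (auto simp: ennreal_powr_ennreal simp flip: ennreal_mult')
    also have "(c powr P * (pi / (P * \<beta>)) powr (real DIM('a) / 2)) powr (1 / P) =
        c * ((pi / P) * (1 / \<beta>)) powr (real DIM('a) / 2 * (1 / P))"
      using finite(2) \<beta> c by (simp add: powr_mult powr_powr)
    also have "\<dots> = c * ((pi / P) powr (real DIM('a) / 2 * (1 / P)) * (1 / \<beta>) powr (real DIM('a) / 2 * (1 / P)))"
      using finite(2) \<beta> by (subst powr_mult) auto
    also have "(1 / \<beta>) powr (real DIM('a) / 2 * (1 / P)) = \<beta> powr (- real DIM('a) / 2 * recip_exponent p)"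
      using \<beta> finite(4) by (simp add: powr_divide powr_minus_divide)
    finally show "Lp_norm lborel p (\<lambda>x. ennreal (c * exp (- \<beta> * (norm (x - x\<^sub>0))\<^sup>2))) =
        ennreal ((pi / P) powr (real DIM('a) / 2 * (1 / P)) * c * \<beta> powr (- real DIM('a) / 2 * recip_exponent p))"
      by (simp add: mult_ac)
  qed
next
  case infinity
  show thesis
  proof (rule that[of 1])
    fix c \<beta> :: real and x\<^sub>0 :: 'a
    assume c: "c \<ge> 0" and \<beta>: "\<beta> > 0"
    let ?g = "\<lambda>x. ennreal (c * exp (- \<beta> * (norm (x - x\<^sub>0))\<^sup>2))"
    have "esssup lborel ?g \<le> esssup lborel (\<lambda>_ :: 'a. ennreal c)"
      using c \<beta> by (intro esssup_mono) (auto intro!: ennreal_leI mult_left_le)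
    also have "\<dots> = ennreal c"
      by (rule esssup_const) simp
    finally have le: "esssup lborel ?g \<le> ennreal c" .
    have "ennreal c \<le> esssup lborel ?g"
    proof (rule dense_le)
      fix y assume y: "y < ennreal c"
      let ?S = "{x. y < ?g x}"
      have "open ?S"
        by (intro open_Collect_less continuous_intros continuous_on_ennreal)
      moreover have "x\<^sub>0 \<in> ?S" using y by simp
      ultimately have "\<not> negligible ?S"
        using open_not_negligible[of ?S] by blast
      then have "?S \<notin> null_sets lborel"
        by (auto simp: negligible_iff_null_sets intro: null_sets_completionI)
      show "y \<le> esssup lborel ?g"
      proof (rule ccontr)
        assume "\<not> y \<le> esssup lborel ?g"
        then have "AE x in lborel. x \<notin> ?S"
          using esssup_AE[of ?g lborel] by (auto elim!: eventually_mono)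
        then have "?S \<in> null_sets lborel"
          using \<open>open ?S\<close> by (subst AE_iff_null_sets) auto
        with \<open>?S \<notin> null_sets lborel\<close> show False by simp
      qed
    qed
    with le show "Lp_norm lborel p ?g = ennreal (1 * c * \<beta> powr (- real DIM('a) / 2 * recip_exponent p))"
      using infinity \<beta> by (simp add: Lp_norm_def)
  qed simp
qed

lemma mixed_norm_lower_bound:
  fixes u :: "(real ^ 'n) \<times> real \<Rightarrow> complex"
  assumes q: "1 \<le> q" and r: "1 \<le> r" and pos: "c > 0" "R > 0" "l > 0"
    and u: "\<And>x t. norm x \<le> R \<Longrightarrow> t\<^sub>0 \<le> t \<Longrightarrow> t \<le> t\<^sub>0 + l \<Longrightarrow> c \<le> cmod (u (x, t))"
  shows "ennreal (c * (unit_ball_vol (real CARD('n)) * R ^ CARD('n)) powr recip_exponent r * l powr recip_exponent q)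
    \<le> mixed_norm q r u"
  unfolding mixed_norm_def
proof (rule Lp_norm_lower_bound[OF q])
  show "{t\<^sub>0..t\<^sub>0 + l} \<in> sets lborel" "emeasure lborel {t\<^sub>0..t\<^sub>0 + l} = ennreal l" "l > 0"
    using pos by auto
  let ?V = "unit_ball_vol (real CARD('n)) * R ^ CARD('n)"
  have V: "?V > 0" using pos by simp
  then show "c * ?V powr recip_exponent r > 0"
    using pos(1) by (metis mult_pos_pos powr_gt_zero less_irrefl)
  fix t assume t: "t \<in> {t\<^sub>0..t\<^sub>0 + l}"
  show "ennreal (c * ?V powr recip_exponent r) \<le> Lp_norm lborel r (\<lambda>x. ennreal (cmod (u (x, t))))"
  proof (rule Lp_norm_lower_bound[OF r])
    show "cball (0 :: real ^ 'n) R \<in> sets lborel" by simp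
    show "emeasure lborel (cball (0 :: real ^ 'n) R) = ennreal ?V"
      using pos by (simp add: emeasure_cball)
    show "ennreal c \<le> ennreal (cmod (u (x, t)))" if "x \<in> cball 0 R" for x
      using u[of x t] that t by (intro ennreal_leI) auto
  qed (use V pos in auto)
qed

section \<open>Norms of wave packets and of their Duhamel integrals\<close>

lemma norm_wave_packet:
  fixes x :: "real ^ 'n"
  assumes "\<delta> > 0"
  shows "cmod (wave_packet m b \<delta> s\<^sub>0 (x, s)) =
    (\<bar>s - s\<^sub>0\<bar> ^ m * exp (- b * (s - s\<^sub>0)\<^sup>2) * cmod (Complex \<delta> (s - s\<^sub>0)) powr (- real CARD('n) / 2)) *
      exp (- (\<delta> / (4 * (cmod (Complex \<delta> (s - s\<^sub>0)))\<^sup>2)) * (norm (x - 0))\<^sup>2)"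
proof -
  have "cmod (wave_packet m b \<delta> s\<^sub>0 (x, s)) =
      \<bar>(s - s\<^sub>0) ^ m * exp (- b * (s - s\<^sub>0)\<^sup>2)\<bar> * cmod (gauss_wave (Complex \<delta> (s - s\<^sub>0)) x)"
    by (simp only: wave_packet_def prod.case norm_mult norm_of_real)
  also have "\<bar>(s - s\<^sub>0) ^ m * exp (- b * (s - s\<^sub>0)\<^sup>2)\<bar> = \<bar>s - s\<^sub>0\<bar> ^ m * exp (- b * (s - s\<^sub>0)\<^sup>2)"
    by (simp add: abs_mult power_abs)
  finally show ?thesis
    unfolding norm_gauss_wave[OF assms] by (simp only: mult.assoc diff_zero)
qed

text \<open>At time \<open>s\<^sub>0 + \<sigma>\<close> the packet is a Gaussian in space of height \<open>|\<delta> + \<i>\<sigma>|\<close> to the power \<open>-n/2\<close>, up to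
  its amplitude, and of squared width of order \<open>|\<delta> + \<i>\<sigma>|\<^sup>2 / \<delta>\<close>. Its norm over space is therefore a power of
  \<open>|\<delta> + \<i>\<sigma>|\<close> times a power of \<open>\<delta>\<close>. If this profile lies below a Gaussian in time, then the norm
  over time is bounded by the known norm of that Gaussian.\<close>

lemma mixed_norm_wave_packet:
  assumes k: "1 \<le> k" and p: "1 \<le> p"
  obtains H where "H > 0"
    "\<And>m b \<delta> s\<^sub>0 K b'. \<delta> > 0 \<Longrightarrow> K \<ge> 0 \<Longrightarrow> b' > 0 \<Longrightarrow>
      (\<And>\<sigma>. \<bar>\<sigma>\<bar> ^ m * exp (- b * \<sigma>\<^sup>2) *
          cmod (Complex \<delta> \<sigma>) powr (real CARD('n) * recip_exponent p - real CARD('n) / 2)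
        \<le> K * exp (- b' * \<sigma>\<^sup>2)) \<Longrightarrow>
      mixed_norm k p (wave_packet m b \<delta> s\<^sub>0 :: (real ^ 'n) \<times> real \<Rightarrow> complex)
        \<le> ennreal (H * K * \<delta> powr (- real CARD('n) / 2 * recip_exponent p) * b' powr (- 1 / 2 * recip_exponent k))"
proof -
  define n where "n = real CARD('n)"
  define \<rho> where "\<rho> = recip_exponent p"
  define \<kappa> where "\<kappa> = recip_exponent k"
  obtain G\<^sub>1 where G1: "G\<^sub>1 > 0" "\<And>c \<beta> (x\<^sub>0 :: real ^ 'n). c \<ge> 0 \<Longrightarrow> \<beta> > 0 \<Longrightarrow>
      Lp_norm lborel p (\<lambda>x. ennreal (c * exp (- \<beta> * (norm (x - x\<^sub>0))\<^sup>2))) =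
        ennreal (G\<^sub>1 * c * \<beta> powr (- n / 2 * \<rho>))"
    using Lp_norm_gaussian[OF p, where 'a = "real ^ 'n"] unfolding n_def \<rho>_def DIM_cart DIM_real mult_1_right by blast
  obtain G\<^sub>2 where G2: "G\<^sub>2 > 0" "\<And>c \<beta> (x\<^sub>0 :: real). c \<ge> 0 \<Longrightarrow> \<beta> > 0 \<Longrightarrow>
      Lp_norm lborel k (\<lambda>x. ennreal (c * exp (- \<beta> * (norm (x - x\<^sub>0))\<^sup>2))) =
        ennreal (G\<^sub>2 * c * \<beta> powr (- 1 / 2 * \<kappa>))"
    using Lp_norm_gaussian[OF k, where 'a = real] unfolding \<kappa>_def DIM_real of_nat_1 by blast
  show thesis
  proof (rule that[of "G\<^sub>2 * G\<^sub>1 * 4 powr (n / 2 * \<rho>)"])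
    show "G\<^sub>2 * G\<^sub>1 * 4 powr (n / 2 * \<rho>) > 0" using G1(1) G2(1) by simp
    fix m :: nat and b \<delta> s\<^sub>0 K b' :: real
    assume \<delta>: "\<delta> > 0" and K: "K \<ge> 0" and b': "b' > 0"
      and le: "\<And>\<sigma>. \<bar>\<sigma>\<bar> ^ m * exp (- b * \<sigma>\<^sup>2) *
          cmod (Complex \<delta> \<sigma>) powr (real CARD('n) * recip_exponent p - real CARD('n) / 2) \<le> K * exp (- b' * \<sigma>\<^sup>2)"
    define L where "L = G\<^sub>1 * 4 powr (n / 2 * \<rho>) * \<delta> powr (- n / 2 * \<rho>)"
    have L: "L \<ge> 0" using G1(1) by (simp add: L_def)
    define f where "f = (\<lambda>s. L * (\<bar>s - s\<^sub>0\<bar> ^ m * exp (- b * (s - s\<^sub>0)\<^sup>2) *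
        cmod (Complex \<delta> (s - s\<^sub>0)) powr (n * \<rho> - n / 2)))"
    have inner: "Lp_norm lborel p (\<lambda>x :: real ^ 'n. ennreal (cmod (wave_packet m b \<delta> s\<^sub>0 (x, s)))) = ennreal (f s)" for s
    proof -
      define Z where "Z = cmod (Complex \<delta> (s - s\<^sub>0))"
      have Z: "Z > 0" using \<delta> by (auto simp: Z_def complex_eq_iff)
      have "Lp_norm lborel p (\<lambda>x :: real ^ 'n. ennreal (cmod (wave_packet m b \<delta> s\<^sub>0 (x, s)))) =
          ennreal (G\<^sub>1 * (\<bar>s - s\<^sub>0\<bar> ^ m * exp (- b * (s - s\<^sub>0)\<^sup>2) * Z powr (- n / 2)) *
            (\<delta> / (4 * Z\<^sup>2)) powr (- n / 2 * \<rho>))"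
        unfolding norm_wave_packet[OF \<delta>] n_def[symmetric] Z_def[symmetric]
        using \<delta> Z by (intro G1(2)) auto
      also have "(\<delta> / (4 * Z\<^sup>2)) powr (- n / 2 * \<rho>) = \<delta> powr (- n / 2 * \<rho>) * (4 powr (n / 2 * \<rho>) * Z powr (n * \<rho>))"
      proof -
        have "(\<delta> / (4 * Z\<^sup>2)) powr (- n / 2 * \<rho>) = \<delta> powr (- n / 2 * \<rho>) * (4 * Z\<^sup>2) powr (n / 2 * \<rho>)"
          using \<delta> Z by (simp add: powr_divide powr_minus_divide)
        also have "(4 * Z\<^sup>2) powr (n / 2 * \<rho>) = 4 powr (n / 2 * \<rho>) * (Z powr 2) powr (n / 2 * \<rho>)"
          using Z by (simp add: powr_mult)
        also have "(Z powr 2) powr (n / 2 * \<rho>) = Z powr (n * \<rho>)"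
          by (simp add: powr_powr)
        finally show ?thesis .
      qed
      also have "G\<^sub>1 * (\<bar>s - s\<^sub>0\<bar> ^ m * exp (- b * (s - s\<^sub>0)\<^sup>2) * Z powr (- n / 2)) *
          (\<delta> powr (- n / 2 * \<rho>) * (4 powr (n / 2 * \<rho>) * Z powr (n * \<rho>))) =
          L * (\<bar>s - s\<^sub>0\<bar> ^ m * exp (- b * (s - s\<^sub>0)\<^sup>2) * (Z powr (n * \<rho>) * Z powr (- n / 2)))"
        by (simp add: L_def mult_ac)
      also have "Z powr (n * \<rho>) * Z powr (- n / 2) = Z powr (n * \<rho> - n / 2)"
        using Z by (simp flip: powr_add)
      finally show ?thesis by (simp only: f_def Z_def)
    qed
    have "mixed_norm k p (wave_packet m b \<delta> s\<^sub>0 :: (real ^ 'n) \<times> real \<Rightarrow> complex) = Lp_norm lborel k (\<lambda>s. ennreal (f s))"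
      by (simp only: mixed_norm_def inner)
    also have "\<dots> \<le> Lp_norm lborel k (\<lambda>s. ennreal ((L * K) * exp (- b' * (norm (s - s\<^sub>0))\<^sup>2)))"
    proof (rule Lp_norm_mono[OF k])
      have "cmod (Complex \<delta> (s - s\<^sub>0)) = sqrt (\<delta>\<^sup>2 + (s - s\<^sub>0)\<^sup>2)" for s
        by (simp add: cmod_def)
      then show "(\<lambda>s. ennreal (f s)) \<in> borel_measurable lborel"
        unfolding f_def by simp
      show "ennreal (f s) \<le> ennreal ((L * K) * exp (- b' * (norm (s - s\<^sub>0))\<^sup>2))" for s
        unfolding f_def using mult_left_mono[OF le[of "s - s\<^sub>0"] L]
        by (intro ennreal_leI) (simp add: n_def \<rho>_def mult.assoc)
    qed
    also have "\<dots> = ennreal (G\<^sub>2 * (L * K) * b' powr (- 1 / 2 * \<kappa>))"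
      using L K b' by (intro G2(2)) auto
    finally show "mixed_norm k p (wave_packet m b \<delta> s\<^sub>0 :: (real ^ 'n) \<times> real \<Rightarrow> complex)
        \<le> ennreal (G\<^sub>2 * G\<^sub>1 * 4 powr (n / 2 * \<rho>) * K * \<delta> powr (- real CARD('n) / 2 * recip_exponent p) *
          b' powr (- 1 / 2 * recip_exponent k))"
      by (simp add: L_def n_def \<rho>_def \<kappa>_def mult_ac)
  qed
qed

lemma interval_integral_lower_bound:
  fixes f :: "real \<Rightarrow> real"
  assumes f: "continuous_on UNIV f" "\<And>s. f s \<ge> 0" and l: "0 \<le> l" "l \<le> t"
    and c: "\<And>s. 0 \<le> s \<Longrightarrow> s \<le> l \<Longrightarrow> c \<le> f s"
  shows "c * l \<le> (LBINT s=ereal 0..ereal t. f s)"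
proof -
  have "c * l = (\<integral>s. c * indicator {0..l} s \<partial>lborel)"
    using l by simp
  also have "\<dots> \<le> (\<integral>s. indicator {0..t} s *\<^sub>R f s \<partial>lborel)"
  proof (rule integral_mono)
    show "integrable lborel (\<lambda>s. c * indicator {0..l} s)"
      using l by (intro integrable_mult_right integrable_real_indicator) auto
    show "integrable lborel (\<lambda>s. indicator {0..t} s *\<^sub>R f s)"
      using borel_integrable_atLeastAtMost'[OF continuous_on_subset[OF f(1)], of 0 t]
      by (simp add: set_integrable_def)
    show "c * indicator {0..l} s \<le> indicator {0..t} s *\<^sub>R f s" for s
      using c f(2) l by (auto split: split_indicator)
  qed
  also have "\<dots> = (LBINT s=ereal 0..ereal t. f s)"
    using l by (simp add: interval_integral_Icc set_lebesgue_integral_def)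
  finally show ?thesis .
qed

text \<open>The time integral of the nonnegative amplitude is bounded below by its part over \<open>[0,l]\<close>, and \<open>x\<close> is
  confined to the region in which the spatial Gaussian is at least \<open>exp (-1)\<close>.\<close>

lemma norm_duhamel_wave_packet_ge:
  fixes x :: "real ^ 'n"
  assumes \<delta>: "\<delta> > 0" and m: "even m" and l: "0 \<le> l" "l \<le> t" and c: "c \<ge> 0"
    and low: "\<And>s. 0 \<le> s \<Longrightarrow> s \<le> l \<Longrightarrow> c \<le> (s - s\<^sub>0) ^ m * exp (- b * (s - s\<^sub>0)\<^sup>2)"
    and Z: "cmod (Complex \<delta> (t - s\<^sub>0)) \<le> \<zeta>"
    and x: "\<delta> * (norm x)\<^sup>2 \<le> 4 * (cmod (Complex \<delta> (t - s\<^sub>0)))\<^sup>2"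
  shows "c * l * (\<zeta> powr (- real CARD('n) / 2) * exp (- 1)) \<le> cmod (duhamel (wave_packet m b \<delta> s\<^sub>0) (x, t))"
proof -
  define Y where "Y = cmod (Complex \<delta> (t - s\<^sub>0))"
  have Y: "Y > 0" using \<delta> by (auto simp: Y_def complex_eq_iff)
  have "c * l \<le> (LBINT s=ereal 0..ereal t. (s - s\<^sub>0) ^ m * exp (- b * (s - s\<^sub>0)\<^sup>2))"
    using m by (intro interval_integral_lower_bound l low continuous_intros mult_nonneg_nonneg) auto
  then have A: "c * l \<le> \<bar>LBINT s=ereal 0..ereal t. (s - s\<^sub>0) ^ m * exp (- b * (s - s\<^sub>0)\<^sup>2)\<bar>"
    by linarith
  have "\<zeta> powr (- real CARD('n) / 2) \<le> Y powr (- real CARD('n) / 2)"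
    using Z Y by (intro powr_mono2') (auto simp: Y_def)
  moreover have "\<delta> / (4 * Y\<^sup>2) * (norm x)\<^sup>2 \<le> 1"
    using x Y by (simp add: Y_def[symmetric] divide_le_eq)
  then have "exp (- 1) \<le> exp (- (\<delta> / (4 * Y\<^sup>2)) * (norm x)\<^sup>2)"
    by simp
  ultimately have "\<zeta> powr (- real CARD('n) / 2) * exp (- 1) \<le> cmod (gauss_wave (Complex \<delta> (t - s\<^sub>0)) x)"
    unfolding norm_gauss_wave[OF \<delta>] Y_def[symmetric] by (intro mult_mono) auto
  with A show ?thesis
    unfolding duhamel_wave_packet[OF \<delta>] norm_mult norm_of_real
    using c l by (intro mult_mono) auto
qed

lemma exponent_le_of_power_bound:
  fixes \<alpha> \<beta> a K :: real
  assumes a: "a > 0" and le: "\<And>\<delta>. 0 < \<delta> \<Longrightarrow> \<delta> \<le> 1 \<Longrightarrow> ennreal (a * \<delta> powr \<alpha>) \<le> ennreal C * ennreal (K * \<delta> powr \<beta>)"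
  shows "\<beta> \<le> \<alpha>"
proof (rule ccontr)
  assume "\<not> \<beta> \<le> \<alpha>"
  then have gap: "\<beta> - \<alpha> > 0" by simp
  define B where "B = max 0 C * max 0 K"
  have B: "B \<ge> 0" by (simp add: B_def)
  \<comment> \<open>Small enough for \<open>B * \<delta> powr (\<beta> - \<alpha>)\<close> to be less than \<open>a\<close>.\<close>
  define \<delta> where "\<delta> = (a / (2 * (B + a))) powr (1 / (\<beta> - \<alpha>))"
  have \<delta>: "\<delta> > 0" "\<delta> \<le> 1"
    using a B gap by (auto simp: \<delta>_def intro!: powr_le1)
  have "ennreal (a * \<delta> powr \<alpha>) \<le> ennreal (max 0 C) * ennreal (max 0 K * \<delta> powr \<beta>)"
    using le[OF \<delta>] by (rule order_trans) (auto intro!: mult_mono ennreal_leI mult_right_mono)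
  then have "a * \<delta> powr \<alpha> \<le> B * \<delta> powr \<beta>"
    by (simp add: B_def mult.assoc flip: ennreal_mult')
  then have "a \<le> B * (\<delta> powr \<beta> / \<delta> powr \<alpha>)"
    using \<delta>(1) by (simp add: field_simps)
  also have "\<delta> powr \<beta> / \<delta> powr \<alpha> = \<delta> powr (\<beta> - \<alpha>)"
    by (simp add: powr_diff)
  also have "\<dots> = a / (2 * (B + a))"
    using gap a B by (simp add: \<delta>_def powr_powr)
  finally have "a * (2 * (B + a)) \<le> B * a"
    using a B by (simp add: field_simps)
  then have "2 * (B + a) \<le> B"
    using a by (simp add: mult.commute)
  moreover have "B < 2 * (B + a)"
    using a B by (simp add: distrib_left)
  ultimately show False by simp
qed

section \<open>The focusing and the dispersing forcing terms\<close>

lemma le_one_plus_of_sq: "z\<^sup>2 \<le> 1 + t \<Longrightarrow> 0 \<le> t \<Longrightarrow> z \<le> 1 + (t::real)"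
  by (rule power2_le_imp_le) (auto simp: power2_sum intro: order_trans)

text \<open>The amplitude has order \<open>2n\<close> at the focus because the spatial norm of the Gaussian wave is, in
  time, a power of \<open>|\<delta> + \<i>\<sigma>|\<close> with exponent at least \<open>-n/2\<close>, times a power of \<open>\<delta>\<close>.
  The first factor is no longer singular in the limit once it is multiplied by the amplitude. The exponents \<open>k\<close> and \<open>p\<close> play the role of the conjugates of \<open>qt\<close> and \<open>rt\<close>.\<close>

lemma focusing_condition:
  fixes q r k p :: ennreal and C :: real
  assumes exps: "1 \<le> q" "1 \<le> r" "1 \<le> k" "1 \<le> p"
    and bound: "\<And>F :: (real ^ 'n) \<times> real \<Rightarrow> complex. schwartz F \<Longrightarrow>
      mixed_norm q r (duhamel F) \<le> ennreal C * mixed_norm k p F"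
  shows "real CARD('n) / 2 * (1 - recip_exponent p) \<le> real CARD('n) / 2 * recip_exponent r + recip_exponent q"
proof -
  define n where "n = CARD('n)"
  define \<rho> where "\<rho> = recip_exponent p"
  have \<rho>: "0 \<le> \<rho>" "\<rho> \<le> 1" using recip_exponent_bounds[OF exps(4)] by (auto simp: \<rho>_def)
  obtain H where H: "H > 0" "\<And>m b \<delta> s\<^sub>0 K b'. \<delta> > 0 \<Longrightarrow> K \<ge> 0 \<Longrightarrow> b' > 0 \<Longrightarrow>
      (\<And>\<sigma>. \<bar>\<sigma>\<bar> ^ m * exp (- b * \<sigma>\<^sup>2) * cmod (Complex \<delta> \<sigma>) powr (real n * \<rho> - real n / 2)
        \<le> K * exp (- b' * \<sigma>\<^sup>2)) \<Longrightarrow>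
      mixed_norm k p (wave_packet m b \<delta> s\<^sub>0 :: (real ^ 'n) \<times> real \<Rightarrow> complex)
        \<le> ennreal (H * K * \<delta> powr (- real n / 2 * \<rho>) * b' powr (- 1 / 2 * recip_exponent k))"
    using mixed_norm_wave_packet[OF exps(3,4), where 'n = 'n] unfolding n_def \<rho>_def by blast
  obtain K where K: "\<And>t::real. t \<ge> 0 \<Longrightarrow> (1 + t) ^ (3 * n) * exp (- (1/2) * t) \<le> K"
    using poly_exp_bounded[of "1/2" "3 * n"] by auto
  have K0: "K \<ge> 0" using K[of 0] by simp
  define h where "h = H * K * (1/2) powr (- 1 / 2 * recip_exponent k)"
  define V where "V = unit_ball_vol (real n)"
  have V: "V > 0" by (simp add: V_def)
  define a where "a = (1/4) ^ n * exp (- 1) * (1/2) * (2 powr (- real n / 2) * exp (- 1)) * V powr recip_exponent r"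
  have "a > 0" using V by (simp add: a_def)
  have "ennreal (a * \<delta> powr (- real n / 2 + real n / 2 * recip_exponent r + recip_exponent q))
      \<le> ennreal C * ennreal (h * \<delta> powr (- real n / 2 * \<rho>))" if \<delta>: "0 < \<delta>" "\<delta> \<le> 1" for \<delta>
  proof -
    let ?F = "wave_packet (2 * n) 1 \<delta> 1 :: (real ^ 'n) \<times> real \<Rightarrow> complex"
    have upper: "mixed_norm k p ?F \<le> ennreal (H * K * \<delta> powr (- real n / 2 * \<rho>) * (1/2) powr (- 1 / 2 * recip_exponent k))"
    proof (rule H(2))
      fix \<sigma> :: real
      define Z where "Z = cmod (Complex \<delta> \<sigma>)"
      have Z0: "Z > 0" using \<delta> by (auto simp: Z_def complex_eq_iff)
      have Zsq: "Z\<^sup>2 = \<delta>\<^sup>2 + \<sigma>\<^sup>2" by (simp add: Z_def cmod_power2)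
      have \<sigma>Z: "\<bar>\<sigma>\<bar> \<le> Z" using abs_Im_le_cmod[of "Complex \<delta> \<sigma>"] by (simp add: Z_def)
      have "\<delta>\<^sup>2 \<le> 1" using \<delta> by (simp add: power_le_one)
      then have Z1: "Z \<le> 1 + \<sigma>\<^sup>2" using Zsq by (auto intro: le_one_plus_of_sq)
      define e where "e = 2 * real n + (real n * \<rho> - real n / 2)"
      have "0 \<le> real n * \<rho>" "real n * \<rho> \<le> real n"
        using \<rho> by (auto intro: mult_left_le)
      then have e: "0 \<le> e" "e \<le> 3 * real n"
        by (auto simp: e_def)
      have "\<bar>\<sigma>\<bar> ^ (2 * n) * Z powr (real n * \<rho> - real n / 2) \<le> Z ^ (2 * n) * Z powr (real n * \<rho> - real n / 2)"
        using \<sigma>Z by (intro mult_right_mono power_mono) auto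
      also have "\<dots> = Z powr e"
        using Z0 by (simp only: e_def powr_add powr_realpow[symmetric] of_nat_mult of_nat_numeral)
      also have "\<dots> \<le> (1 + \<sigma>\<^sup>2) powr e"
        using Z0 Z1 e by (intro powr_mono2) auto
      also have "\<dots> \<le> (1 + \<sigma>\<^sup>2) powr (3 * real n)"
        using e by (intro powr_mono) auto
      also have "\<dots> = (1 + \<sigma>\<^sup>2) ^ (3 * n)"
        by (simp add: add_pos_nonneg flip: powr_realpow)
      finally have "\<bar>\<sigma>\<bar> ^ (2 * n) * Z powr (real n * \<rho> - real n / 2) * exp (- 1 * \<sigma>\<^sup>2) \<le>
          (1 + \<sigma>\<^sup>2) ^ (3 * n) * exp (- 1 * \<sigma>\<^sup>2)"
        by (intro mult_right_mono) auto
      also have "\<dots> = ((1 + \<sigma>\<^sup>2) ^ (3 * n) * exp (- (1/2) * \<sigma>\<^sup>2)) * exp (- (1/2) * \<sigma>\<^sup>2)"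
        by (simp add: mult.assoc flip: exp_add)
      also have "\<dots> \<le> K * exp (- (1/2) * \<sigma>\<^sup>2)"
        by (intro mult_right_mono K) auto
      finally show "\<bar>\<sigma>\<bar> ^ (2 * n) * exp (- 1 * \<sigma>\<^sup>2) * cmod (Complex \<delta> \<sigma>) powr (real n * \<rho> - real n / 2)
          \<le> K * exp (- (1/2) * \<sigma>\<^sup>2)"
        by (simp only: Z_def mult_ac)
    qed (use \<delta> K0 in auto)
    define R where "R = \<delta> powr (1/2)"
    have R: "R > 0" "R\<^sup>2 = \<delta>" "R ^ n = \<delta> powr (real n / 2)"
      using \<delta> by (simp_all add: R_def powr_power)
    define c where "c = (1/4) ^ n * exp (- 1) * (1/2) * ((2 * \<delta>) powr (- real n / 2) * exp (- 1))"
    have c: "c > 0" using \<delta> by (simp add: c_def)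
    have "c \<le> cmod (duhamel ?F (x, t))" if x: "norm x \<le> R" and t: "1 \<le> t" "t \<le> 1 + \<delta>" for x t
      unfolding c_def n_def
    proof (rule norm_duhamel_wave_packet_ge)
      fix s :: real assume s: "0 \<le> s" "s \<le> 1/2"
      have "(1/2)\<^sup>2 \<le> (1 - s)\<^sup>2" "(1 - s)\<^sup>2 \<le> 1\<^sup>2"
        using s by (intro power_mono; simp)+
      then have s2: "1/4 \<le> (s - 1)\<^sup>2" "(s - 1)\<^sup>2 \<le> 1"
        by (simp_all add: power2_commute[of s 1] power_divide)
      show "(1/4) ^ CARD('n) * exp (- 1) \<le> (s - 1) ^ (2 * CARD('n)) * exp (- 1 * (s - 1)\<^sup>2)"
        unfolding power_mult using s2 by (intro mult_mono power_mono) auto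
    next
      have Z: "(cmod (Complex \<delta> (t - 1)))\<^sup>2 = \<delta>\<^sup>2 + (t - 1)\<^sup>2" by (simp add: cmod_power2)
      have "(t - 1)\<^sup>2 \<le> \<delta>\<^sup>2" using t by (intro power_mono) auto
      moreover have "(2 * \<delta>)\<^sup>2 = 4 * \<delta>\<^sup>2" by (simp add: power_mult_distrib)
      ultimately have "(cmod (Complex \<delta> (t - 1)))\<^sup>2 \<le> (2 * \<delta>)\<^sup>2"
        using zero_le_power2[of \<delta>] unfolding Z by linarith
      then show "cmod (Complex \<delta> (t - 1)) \<le> 2 * \<delta>"
        by (rule power2_le_imp_le) (use \<delta> in auto)
      have "(norm x)\<^sup>2 \<le> \<delta>"
        using power_mono[OF x, of 2] R by simp
      then have "\<delta> * (norm x)\<^sup>2 \<le> \<delta> * \<delta>"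
        using \<delta> by (intro mult_left_mono) auto
      also have "\<dots> \<le> 4 * (\<delta>\<^sup>2 + (t - 1)\<^sup>2)"
        using zero_le_power2[of \<delta>] zero_le_power2[of "t - 1"] by (simp add: power2_eq_square)
      finally show "\<delta> * (norm x)\<^sup>2 \<le> 4 * (cmod (Complex \<delta> (t - 1)))\<^sup>2"
        by (simp only: Z)
    qed (use \<delta> t in auto)
    then have lower: "ennreal (c * (V * R ^ n) powr recip_exponent r * \<delta> powr recip_exponent q)
        \<le> mixed_norm q r (duhamel ?F)"
      unfolding V_def n_def
      by (intro mixed_norm_lower_bound[where t\<^sub>0 = 1] exps c R(1) \<delta>(1)) (auto simp: n_def)
    have "c * (V * R ^ n) powr recip_exponent r * \<delta> powr recip_exponent q =
        a * (\<delta> powr (- real n / 2) * \<delta> powr (real n / 2 * recip_exponent r) * \<delta> powr recip_exponent q)"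
      using \<delta> V unfolding c_def a_def R(3) by (simp add: powr_mult powr_powr mult_ac)
    also have "\<dots> = a * \<delta> powr (- real n / 2 + real n / 2 * recip_exponent r + recip_exponent q)"
      by (simp only: powr_add)
    finally have "ennreal (a * \<delta> powr (- real n / 2 + real n / 2 * recip_exponent r + recip_exponent q))
        \<le> mixed_norm q r (duhamel ?F)"
      using lower by simp
    also have "\<dots> \<le> ennreal C * mixed_norm k p ?F"
      using \<delta> by (intro bound schwartz_wave_packet) auto
    also have "\<dots> \<le> ennreal C * ennreal (h * \<delta> powr (- real n / 2 * \<rho>))"
      using upper by (intro mult_left_mono) (auto simp: h_def mult_ac)
    finally show ?thesis .
  qed
  then have "- real n / 2 * \<rho> \<le> - real n / 2 + real n / 2 * recip_exponent r + recip_exponent q"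
    by (rule exponent_le_of_power_bound[OF \<open>a > 0\<close>])
  then show ?thesis
    by (simp add: n_def \<rho>_def algebra_simps)
qed

text \<open>The amplitude \<open>exp (-(s/\<delta>)\<^sup>2)\<close> is adapted to the time for which the wave stays focused, so after
  rescaling \<open>s\<close> by \<open>\<delta>\<close> the profile in time does not depend on \<open>\<delta>\<close> any more, except for a power
  of \<open>\<delta>\<close> in front.\<close>

lemma dispersing_condition:
  fixes q r k p :: ennreal and C :: real
  assumes exps: "1 \<le> q" "1 \<le> r" "1 \<le> k" "1 \<le> p"
    and bound: "\<And>F :: (real ^ 'n) \<times> real \<Rightarrow> complex. schwartz F \<Longrightarrow>
      mixed_norm q r (duhamel F) \<le> ennreal C * mixed_norm k p F"
  shows "real CARD('n) / 2 * recip_exponent r \<le> real CARD('n) / 2 * (1 - recip_exponent p) + (1 - recip_exponent k)"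
proof -
  define n where "n = CARD('n)"
  define \<rho> where "\<rho> = recip_exponent p"
  define \<kappa> where "\<kappa> = recip_exponent k"
  have \<rho>: "0 \<le> \<rho>" "\<rho> \<le> 1" using recip_exponent_bounds[OF exps(4)] by (auto simp: \<rho>_def)
  obtain H where H: "H > 0" "\<And>m b \<delta> s\<^sub>0 K b'. \<delta> > 0 \<Longrightarrow> K \<ge> 0 \<Longrightarrow> b' > 0 \<Longrightarrow>
      (\<And>\<sigma>. \<bar>\<sigma>\<bar> ^ m * exp (- b * \<sigma>\<^sup>2) * cmod (Complex \<delta> \<sigma>) powr (real n * \<rho> - real n / 2)
        \<le> K * exp (- b' * \<sigma>\<^sup>2)) \<Longrightarrow>
      mixed_norm k p (wave_packet m b \<delta> s\<^sub>0 :: (real ^ 'n) \<times> real \<Rightarrow> complex)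
        \<le> ennreal (H * K * \<delta> powr (- real n / 2 * \<rho>) * b' powr (- 1 / 2 * \<kappa>))"
    using mixed_norm_wave_packet[OF exps(3,4), where 'n = 'n] unfolding n_def \<rho>_def \<kappa>_def by blast
  obtain K where K: "\<And>t::real. t \<ge> 0 \<Longrightarrow> (1 + t) ^ n * exp (- (1/2) * t) \<le> K"
    using poly_exp_bounded[of "1/2" n] by auto
  have K0: "K \<ge> 0" using K[of 0] by simp
  define h where "h = H * K * (1/2) powr (- 1 / 2 * \<kappa>)"
  define V where "V = unit_ball_vol (real n)"
  have V: "V > 0" by (simp add: V_def)
  define a where "a = exp (- 1) * (3 powr (- real n / 2) * exp (- 1)) * V powr recip_exponent r"
  have "a > 0" using V by (simp add: a_def)
  have "ennreal (a * \<delta> powr (1 - real n / 2 * recip_exponent r))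
      \<le> ennreal C * ennreal (h * \<delta> powr (real n / 2 * \<rho> - real n / 2 + \<kappa>))" if \<delta>: "0 < \<delta>" "\<delta> \<le> 1" for \<delta>
  proof -
    let ?F = "wave_packet 0 (1 / \<delta>\<^sup>2) \<delta> 0 :: (real ^ 'n) \<times> real \<Rightarrow> complex"
    define e where "e = real n * \<rho> - real n / 2"
    have upper: "mixed_norm k p ?F \<le> ennreal (H * (K * \<delta> powr e) * \<delta> powr (- real n / 2 * \<rho>) * (1 / (2 * \<delta>\<^sup>2)) powr (- 1 / 2 * \<kappa>))"
    proof (rule H(2))
      fix \<sigma> :: real
      define Z where "Z = cmod (Complex \<delta> \<sigma>)"
      define \<tau> where "\<tau> = \<sigma>\<^sup>2 / \<delta>\<^sup>2"
      have \<tau>: "\<tau> \<ge> 0" by (simp add: \<tau>_def)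
      have Z0: "\<delta> \<le> Z" using abs_Re_le_cmod[of "Complex \<delta> \<sigma>"] \<delta> by (simp add: Z_def)
      have "(Z / \<delta>)\<^sup>2 = 1 + \<tau>"
        using \<delta> by (simp add: Z_def cmod_power2 power_divide \<tau>_def add_divide_distrib)
      then have Z1: "Z / \<delta> \<le> 1 + \<tau>" using \<tau> by (auto intro: le_one_plus_of_sq)
      have "real n * \<rho> \<le> real n" using \<rho> by (auto intro: mult_left_le)
      then have e: "e \<le> real n" by (simp add: e_def)
      have "Z powr e = \<delta> powr e * (Z / \<delta>) powr e"
        using Z0 \<delta> by (simp add: powr_divide)
      also have "\<dots> \<le> \<delta> powr e * (1 + \<tau>) ^ n"
      proof (intro mult_left_mono)
        have "(Z / \<delta>) powr e \<le> (Z / \<delta>) powr real n"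
          using Z0 \<delta> e by (intro powr_mono) auto
        also have "\<dots> \<le> (1 + \<tau>) powr real n"
          using Z0 Z1 \<delta> by (intro powr_mono2) auto
        also have "\<dots> = (1 + \<tau>) ^ n"
          using \<tau> by (intro powr_realpow) auto
        finally show "(Z / \<delta>) powr e \<le> (1 + \<tau>) ^ n" .
      qed simp
      finally have "exp (- \<tau>) * Z powr e \<le> exp (- \<tau>) * (\<delta> powr e * (1 + \<tau>) ^ n)"
        by (intro mult_left_mono) auto
      also have "\<dots> = \<delta> powr e * exp (- (1/2) * \<tau>) * ((1 + \<tau>) ^ n * exp (- (1/2) * \<tau>))"
      proof -
        have "exp (- \<tau>) = exp (- (1/2) * \<tau>) * exp (- (1/2) * \<tau>)"
          by (simp flip: exp_add)
        then show ?thesis by (simp only: mult_ac)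
      qed
      also have "\<dots> \<le> \<delta> powr e * exp (- (1/2) * \<tau>) * K"
        using \<tau> by (intro mult_left_mono K) auto
      finally have "exp (- \<tau>) * Z powr e \<le> \<delta> powr e * exp (- (1/2) * \<tau>) * K" .
      moreover have "- (1 / \<delta>\<^sup>2) * \<sigma>\<^sup>2 = - \<tau>" "- (1 / (2 * \<delta>\<^sup>2)) * \<sigma>\<^sup>2 = - (1/2) * \<tau>"
        by (simp_all add: \<tau>_def)
      ultimately show "\<bar>\<sigma>\<bar> ^ 0 * exp (- (1 / \<delta>\<^sup>2) * \<sigma>\<^sup>2) * cmod (Complex \<delta> \<sigma>) powr (real n * \<rho> - real n / 2)
          \<le> K * \<delta> powr e * exp (- (1 / (2 * \<delta>\<^sup>2)) * \<sigma>\<^sup>2)"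
        unfolding Z_def[symmetric] e_def[symmetric] by (simp only: power_0 mult_1_left mult_ac)
    qed (use \<delta> K0 in auto)
    have "(1 / (2 * \<delta>\<^sup>2)) powr (- 1 / 2 * \<kappa>) = (1/2) powr (- 1 / 2 * \<kappa>) * (\<delta> powr (- 2)) powr (- 1 / 2 * \<kappa>)"
      using \<delta> by (subst powr_mult[symmetric]) (auto simp: powr_minus_divide)
    also have "(\<delta> powr (- 2)) powr (- 1 / 2 * \<kappa>) = \<delta> powr \<kappa>"
      by (simp add: powr_powr)
    finally have "H * (K * \<delta> powr e) * \<delta> powr (- real n / 2 * \<rho>) * (1 / (2 * \<delta>\<^sup>2)) powr (- 1 / 2 * \<kappa>) =
        h * (\<delta> powr e * \<delta> powr (- real n / 2 * \<rho>) * \<delta> powr \<kappa>)"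
      by (simp add: h_def mult_ac)
    also have "\<delta> powr e * \<delta> powr (- real n / 2 * \<rho>) * \<delta> powr \<kappa> = \<delta> powr (real n / 2 * \<rho> - real n / 2 + \<kappa>)"
      by (simp add: e_def algebra_simps flip: powr_add)
    finally have upper': "mixed_norm k p ?F \<le> ennreal (h * \<delta> powr (real n / 2 * \<rho> - real n / 2 + \<kappa>))"
      using upper by simp
    define R where "R = \<delta> powr (- (1/2))"
    have R: "R > 0" "R\<^sup>2 = 1 / \<delta>" "R ^ n = \<delta> powr (- (real n / 2))"
      using \<delta> by (simp_all add: R_def powr_power powr_minus_divide power_divide)
    define c where "c = exp (- 1) * \<delta> * (3 powr (- real n / 2) * exp (- 1))"
    have c: "c > 0" using \<delta> by (simp add: c_def)
    have "c \<le> cmod (duhamel ?F (x, t))" if x: "norm x \<le> R" and t: "1 \<le> t" "t \<le> 1 + 1" for x t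
      unfolding c_def n_def
    proof (rule norm_duhamel_wave_packet_ge)
      fix s :: real assume s: "0 \<le> s" "s \<le> \<delta>"
      have "s\<^sup>2 \<le> \<delta>\<^sup>2" using s by (intro power_mono) auto
      then show "exp (- 1) \<le> (s - 0) ^ 0 * exp (- (1 / \<delta>\<^sup>2) * (s - 0)\<^sup>2)"
        using \<delta> by (simp add: divide_le_eq)
    next
      have Z: "(cmod (Complex \<delta> (t - 0)))\<^sup>2 = \<delta>\<^sup>2 + t\<^sup>2" by (simp add: cmod_power2)
      have t2: "t\<^sup>2 \<le> 2\<^sup>2" "1\<^sup>2 \<le> t\<^sup>2" "\<delta>\<^sup>2 \<le> 1\<^sup>2" using t \<delta> by (intro power_mono; simp)+
      then have "(cmod (Complex \<delta> (t - 0)))\<^sup>2 \<le> 3\<^sup>2"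
        unfolding Z by simp
      then show "cmod (Complex \<delta> (t - 0)) \<le> 3"
        by (rule power2_le_imp_le) auto
      have "(norm x)\<^sup>2 \<le> 1 / \<delta>"
        using power_mono[OF x, of 2] R by simp
      then have "\<delta> * (norm x)\<^sup>2 \<le> 1"
        using \<delta> by (simp add: field_simps)
      also have "1 \<le> 4 * (\<delta>\<^sup>2 + t\<^sup>2)"
        using t2(2) zero_le_power2[of \<delta>] unfolding one_power2 distrib_left by linarith
      finally show "\<delta> * (norm x)\<^sup>2 \<le> 4 * (cmod (Complex \<delta> (t - 0)))\<^sup>2"
        by (simp only: Z)
    qed (use \<delta> t in auto)
    then have lower: "ennreal (c * (V * R ^ n) powr recip_exponent r * 1 powr recip_exponent q)
        \<le> mixed_norm q r (duhamel ?F)"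
      unfolding V_def n_def
      by (intro mixed_norm_lower_bound[where t\<^sub>0 = 1] exps c R(1)) (auto simp: n_def)
    have "c * (V * R ^ n) powr recip_exponent r * 1 powr recip_exponent q =
        a * (\<delta> powr 1 * \<delta> powr (- (real n / 2) * recip_exponent r))"
      using \<delta> V unfolding c_def a_def R(3) by (simp add: powr_mult powr_powr mult_ac)
    also have "\<dots> = a * \<delta> powr (1 - real n / 2 * recip_exponent r)"
      by (simp only: powr_add diff_conv_add_uminus mult_minus_left)
    finally have "ennreal (a * \<delta> powr (1 - real n / 2 * recip_exponent r)) \<le> mixed_norm q r (duhamel ?F)"
      using lower by simp
    also have "\<dots> \<le> ennreal C * mixed_norm k p ?F"
      using \<delta> by (intro bound schwartz_wave_packet) auto
    also have "\<dots> \<le> ennreal C * ennreal (h * \<delta> powr (real n / 2 * \<rho> - real n / 2 + \<kappa>))"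
      using upper' by (intro mult_left_mono) auto
    finally show ?thesis .
  qed
  then have "real n / 2 * \<rho> - real n / 2 + \<kappa> \<le> 1 - real n / 2 * recip_exponent r"
    by (rule exponent_le_of_power_bound[OF \<open>a > 0\<close>])
  then show ?thesis
    by (simp add: n_def \<rho>_def \<kappa>_def algebra_simps diff_divide_distrib)
qed

lemma conjugate_exponent_props:
  assumes "1 \<le> p"
  shows "1 \<le> conjugate_exponent p" and "recip_exponent (conjugate_exponent p) = 1 - recip_exponent p"
proof -
  have eq: "1 / p + 1 / conjugate_exponent p = 1"
    using conjugate_exponent_unique[OF assms] by blast
  have le: "1 / conjugate_exponent p \<le> 1"
    using eq by (metis add.commute le_iff_add)
  then show "1 \<le> conjugate_exponent p"
  proof (cases "conjugate_exponent p")
    case (real P)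
    with le have "P \<noteq> 0" by (auto simp: divide_ennreal_def top_unique)
    with le real show ?thesis
      using divide_ennreal[of 1 P] by (simp add: divide_le_eq)
  qed simp
  have "1 / p \<le> 1" using eq by (metis le_iff_add)
  then have "1 / p < top" "1 / conjugate_exponent p < top"
    using le by (auto simp: order_le_less_trans)
  then have "enn2real (1 / p) + enn2real (1 / conjugate_exponent p) = 1"
    using enn2real_plus[of "1 / p" "1 / conjugate_exponent p"] eq by simp
  then show "recip_exponent (conjugate_exponent p) = 1 - recip_exponent p"
    by (simp add: recip_exponent_def)
qed

theorem mainTheorem2:
  fixes q qt r rt :: ennreal and C :: real
  assumes "1 \<le> q" and "1 \<le> qt" and "1 \<le> r" and "1 \<le> rt"
    and "\<And>F :: (real ^ 'n) \<times> real \<Rightarrow> complex. schwartz F \<Longrightarrow>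
           mixed_norm q r (duhamel F)
             \<le> ennreal C * mixed_norm (conjugate_exponent qt) (conjugate_exponent rt) F"
    and "\<And>(F :: (real ^ 'n) \<times> real \<Rightarrow> complex) u.
           bounded_compactly_supported F \<Longrightarrow> is_duhamel F u \<Longrightarrow>
           mixed_norm q r u
             \<le> ennreal C * mixed_norm (conjugate_exponent qt) (conjugate_exponent rt) F"
  shows "(real CARD('n) - 2) * recip_exponent rt - 2 * recip_exponent q
           \<le> real CARD('n) * recip_exponent r
       \<and> (real CARD('n) - 2) * recip_exponent r - 2 * recip_exponent qt
           \<le> real CARD('n) * recip_exponent rt"
proof
  note conj = conjugate_exponent_props[OF assms(2)] conjugate_exponent_props[OF assms(4)]
  have "real CARD('n) / 2 * recip_exponent rt \<le> real CARD('n) / 2 * recip_exponent r + recip_exponent q"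
    using focusing_condition[OF assms(1,3) conj(1,3) assms(5)] by (simp add: conj)
  then show "(real CARD('n) - 2) * recip_exponent rt - 2 * recip_exponent q \<le> real CARD('n) * recip_exponent r"
    using recip_exponent_bounds(1)[OF assms(4)] by (simp add: algebra_simps)
  have "real CARD('n) / 2 * recip_exponent r \<le> real CARD('n) / 2 * recip_exponent rt + recip_exponent qt"
    using dispersing_condition[OF assms(1,3) conj(1,3) assms(5)] by (simp add: conj)
  then show "(real CARD('n) - 2) * recip_exponent r - 2 * recip_exponent qt \<le> real CARD('n) * recip_exponent rt"
    using recip_exponent_bounds(1)[OF assms(3)] by (simp add: algebra_simps)
qed

end
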